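(* In the model filiform group $\mathbb{E}_n$, the directions $\pm X_2$ are deformable for $n=2$ and $n=3$. They are not deformable for $n\ge4$.
   Context: For $n\ge2$, the model filiform group $\mathbb{E}_n$ is the Carnot group (simply connected stratified nilpotent Lie group) of step $n-1$ whose Lie algebra has a basis $X_1,\dots,X_n$ with only non-vanishing bracket relations $[X_i,X_1]=X_{i+1}$ for $1<i<n$, with stratification $V_1=\mathrm{Span}\{X_1,X_2\}$ (the horizontal layer) and $V_i=\mathrm{Span}\{X_{i+1}\}$ for $1<i<n$. Elements of the Lie algebra are regarded as left-invariant vector fields. Identify $\mathbb{E}_n$ with $\mathbb{R}^n$ by $(x_1,\dots,x_n)\leftrightarrow\exp(x_1X_1+\cdots+x_nX_n)$ (the identity is $0$). $\omega$ is the inner product norm on $V_1$ making $X_1,X_2$ orthonormal; $p(x)=(x_1,x_2)$ for $x\in\mathbb{E}_n$, and $p(E)=(a_1,a_2)$ for $E=a_1X_1+a_2X_2$; then $\exp(E)=E(0)=(p(E),0)$. $\langle\cdot,\cdot\rangle$ is the Euclidean inner product in coordinates. Dilations: $\delta_\lambda(\exp(\sum_iY_i))=\exp(\sum_i\lambda^iY_i)$ for $\lambda>0$, $Y_i\in V_i$. An absolutely continuous curve $\gamma:[a,b]\to\mathbb{E}_n$ is horizontal if $\gamma'(t)=u_1(t)X_1(\gamma(t))+u_2(t)X_2(\gamma(t))$ for a.e. $t$ with $u_1,u_2\in L^1[a,b]$; its length is $\int_a^b|u|$. The Carnot-Carathéodory distance $d(x,y)$ is the infimum of lengths of horizontal curves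 joining $x$ to $y$; $d(x)=d(x,0)$. $\mathrm{Lip}_{\mathbb{G}}$ is the Lipschitz constant with respect to $d$ (with $\mathbb{G}=\mathbb{E}_n$). Horizontal lines are curves $t\mapsto q\exp(tV)$ with $q\in\mathbb{G}$, $V\in V_1$. A curve is formed by joining at most $N$ horizontal lines if its domain can be divided into at most $N$ consecutive intervals on each of which it coincides with a horizontal line. $E\in V_1$ with $\omega(E)=1$ is deformable if there exist a positive constant $C_E$, a positive integer $N_E$ and a map $\Delta_E:(0,\infty)\to(0,\infty)$ such that for every $0<\ell<1$, $\eta\in(0,\infty)$, $0<\Delta<\Delta_E(\eta)$ and $u\in\mathbb{G}$ with $d(u)\le1$, there is a Lipschitz horizontal curve $g:\mathbb{R}\to\mathbb{G}$ formed by joining at most $N_E$ horizontal lines such that: (1) $g(t)=\exp(tE)$ for $|t|\ge \ell$; (2) $g(\zeta)=\delta_{\Delta \ell}(u)$ where $\zeta:=\langle\delta_{\Delta \ell}(u),E(0)\rangle$; (3) $\mathrm{Lip}_{\mathbb{G}}(g)\le1+\eta\Delta$; (4) $|(p\circ g)'(t)-p(E)|\le C_E\Delta$ for all but finitely many $t\in\mathbb{R}$. *)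

theory Defs
  imports "HOL-Analysis.Analysis"
begin

section \<open>The model filiform Lie algebra and group\<close>

text \<open>Points of the group \<open>E_n\<close> and elements of its Lie algebra are both represented by their
  coordinates with respect to \<open>X_1, \<dots>, X_n\<close>, i.e. by functions \<open>nat \<Rightarrow> real\<close> vanishing outside
  \<open>{1..n}\<close>.  Since the group carries exponential coordinates of the first kind, \<open>exp\<close> is the
  identity in this representation.\<close>

definition coords :: "nat \<Rightarrow> (nat \<Rightarrow> real) set" where
  "coords n = {x. \<forall>i. i \<notin> {1..n} \<longrightarrow> x i = 0}"

definition basis_vec :: "nat \<Rightarrow> nat \<Rightarrow> real" where
  "basis_vec j = (\<lambda>i. if i = j then 1 else 0)"

definition origin :: "nat \<Rightarrow> real" where
  "origin = (\<lambda>i. 0)"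

definition scale :: "real \<Rightarrow> (nat \<Rightarrow> real) \<Rightarrow> nat \<Rightarrow> real" where
  "scale c x = (\<lambda>i. c * x i)"

text \<open>The bilinear extension of \<open>[X_i, X_1] = X_(i+1)\<close>, \<open>1 < i < n\<close>.\<close>

definition bracket :: "nat \<Rightarrow> (nat \<Rightarrow> real) \<Rightarrow> (nat \<Rightarrow> real) \<Rightarrow> nat \<Rightarrow> real" where
  "bracket n x y = (\<lambda>i. if i \<in> {3..n} then x (i - 1) * y 1 - y (i - 1) * x 1 else 0)"

text \<open>For \<open>v\<close> in the abelian ideal \<open>V = Span {X_2, \<dots>, X_n}\<close> (the coordinate \<open>v 1\<close> is ignored) this
  is \<open>\<Sum>k. c k (a ad X_1)^k v\<close>; note that \<open>ad X_1\<close> maps \<open>X_i\<close> to \<open>- X_(i+1)\<close>.\<close>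

definition ad_series :: "nat \<Rightarrow> (nat \<Rightarrow> real) \<Rightarrow> real \<Rightarrow> (nat \<Rightarrow> real) \<Rightarrow> nat \<Rightarrow> real" where
  "ad_series n c a v =
     (\<lambda>i. if i \<in> {2..n} then \<Sum>k\<le>i - 2. c k * (- a) ^ k * v (i - k) else 0)"

text \<open>The Lie algebra is the semidirect product of \<open>V\<close> and the line spanned by \<open>X_1\<close>, so the simply
  connected group is the semidirect product of \<open>V\<close> and the real line, in which \<open>a\<close> acts on \<open>V\<close> by
  \<open>e^(a ad X_1)\<close>.  The first coordinate stores the real factor.\<close>

definition sd_mult :: "nat \<Rightarrow> (nat \<Rightarrow> real) \<Rightarrow> (nat \<Rightarrow> real) \<Rightarrow> nat \<Rightarrow> real" where
  "sd_mult n p q =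
     (\<lambda>i. if i = 1 then p 1 + q 1 else p i + ad_series n (\<lambda>k. 1 / fact k) (p 1) q i)"

text \<open>The exponential map into the semidirect product:
  \<open>exp (a X_1 + v) = (a, ((e^z - 1) / z) v)\<close> with \<open>z = a ad X_1\<close>.\<close>

definition sd_exp :: "nat \<Rightarrow> (nat \<Rightarrow> real) \<Rightarrow> nat \<Rightarrow> real" where
  "sd_exp n x =
     (\<lambda>i. if i = 1 then x 1 else ad_series n (\<lambda>k. 1 / fact (Suc k)) (x 1) x i)"

text \<open>The group law of \<open>E_n\<close> in exponential coordinates of the first kind, i.e.
  \<open>x y = log (exp x exp y)\<close>.  The lemmas \<open>filiform_group\<close>, \<open>filiform_one_param\<close> and \<open>filiform_Ad\<close>
  below certify that this is the group with Lie algebra \<open>bracket n\<close>, in these coordinates.\<close>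

definition mult :: "nat \<Rightarrow> (nat \<Rightarrow> real) \<Rightarrow> (nat \<Rightarrow> real) \<Rightarrow> nat \<Rightarrow> real" where
  "mult n x y = inv_into (coords n) (sd_exp n) (sd_mult n (sd_exp n x) (sd_exp n y))"

text \<open>\<open>E\<close> as a left-invariant vector field, evaluated at the point \<open>x\<close>.\<close>

definition left_inv_field :: "nat \<Rightarrow> (nat \<Rightarrow> real) \<Rightarrow> (nat \<Rightarrow> real) \<Rightarrow> nat \<Rightarrow> real" where
  "left_inv_field n E x = (\<lambda>i. deriv (\<lambda>t. mult n x (scale t E) i) 0)"

definition horizontal_layer :: "nat \<Rightarrow> (nat \<Rightarrow> real) set" where
  "horizontal_layer n = {E. \<exists>a1 a2. E = (\<lambda>i. a1 * basis_vec 1 i + a2 * basis_vec 2 i)}"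

definition proj :: "(nat \<Rightarrow> real) \<Rightarrow> real \<times> real" where
  "proj x = (x 1, x 2)"

definition omega :: "(nat \<Rightarrow> real) \<Rightarrow> real" where
  "omega E = norm (proj E)"

definition inner_n :: "nat \<Rightarrow> (nat \<Rightarrow> real) \<Rightarrow> (nat \<Rightarrow> real) \<Rightarrow> real" where
  "inner_n n x y = (\<Sum>i\<in>{1..n}. x i * y i)"

text \<open>\<open>X_1, X_2\<close> have weight 1 and \<open>X_i\<close> has weight \<open>i - 1\<close> for \<open>i \<ge> 2\<close>.\<close>

definition dilation :: "real \<Rightarrow> (nat \<Rightarrow> real) \<Rightarrow> nat \<Rightarrow> real" where
  "dilation r x = (\<lambda>i. r ^ (if i = 1 then 1 else i - 1) * x i)"


section \<open>Horizontal curves and the Carnot-Caratheodory distance\<close>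

definition abs_continuous :: "(real \<Rightarrow> real) \<Rightarrow> real \<Rightarrow> real \<Rightarrow> bool" where
  "abs_continuous f a b \<longleftrightarrow>
     (\<forall>e>0. \<exists>d>0. \<forall>(m::nat) l r.
        (\<forall>k<m. a \<le> l k \<and> l k \<le> r k \<and> r k \<le> b) \<and>
        (\<forall>j<m. \<forall>k<m. j \<noteq> k \<longrightarrow> {l j<..<r j} \<inter> {l k<..<r k} = {}) \<and>
        (\<Sum>k<m. r k - l k) < d
        \<longrightarrow> (\<Sum>k<m. \<bar>f (r k) - f (l k)\<bar>) < e)"

text \<open>The curve \<open>\<gamma>\<close>, restricted to \<open>[a, b]\<close>, is horizontal with controls \<open>u1, u2\<close>.\<close>

definition horizontal_with ::
  "nat \<Rightarrow> real \<Rightarrow> real \<Rightarrow> (real \<Rightarrow> nat \<Rightarrow> real) \<Rightarrow> (real \<Rightarrow> real) \<Rightarrow> (real \<Rightarrow> real) \<Rightarrow> bool" where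
  "horizontal_with n a b \<gamma> u1 u2 \<longleftrightarrow>
     a \<le> b \<and> (\<forall>t\<in>{a..b}. \<gamma> t \<in> coords n) \<and>
     (\<forall>i\<in>{1..n}. abs_continuous (\<lambda>t. \<gamma> t i) a b) \<and>
     set_integrable lebesgue {a..b} u1 \<and> set_integrable lebesgue {a..b} u2 \<and>
     (AE t in lebesgue. t \<in> {a..b} \<longrightarrow>
        (\<forall>i\<in>{1..n}. ((\<lambda>s. \<gamma> s i) has_real_derivative
            (u1 t * left_inv_field n (basis_vec 1) (\<gamma> t) i + u2 t * left_inv_field n (basis_vec 2) (\<gamma> t) i))
          (at t within {a..b})))"

definition curve_length :: "real \<Rightarrow> real \<Rightarrow> (real \<Rightarrow> real) \<Rightarrow> (real \<Rightarrow> real) \<Rightarrow> real" where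
  "curve_length a b u1 u2 = (LINT t:{a..b}|lebesgue. norm (u1 t, u2 t))"

definition cc_dist :: "nat \<Rightarrow> (nat \<Rightarrow> real) \<Rightarrow> (nat \<Rightarrow> real) \<Rightarrow> real" where
  "cc_dist n x y =
     Inf {curve_length a b u1 u2 | a b u1 u2.
            \<exists>\<gamma>. horizontal_with n a b \<gamma> u1 u2 \<and> \<gamma> a = x \<and> \<gamma> b = y}"

definition cc_norm :: "nat \<Rightarrow> (nat \<Rightarrow> real) \<Rightarrow> real" where
  "cc_norm n x = cc_dist n x origin"

definition horizontal_curve :: "nat \<Rightarrow> (real \<Rightarrow> nat \<Rightarrow> real) \<Rightarrow> bool" where
  "horizontal_curve n g \<longleftrightarrow> (\<forall>a b. a \<le> b \<longrightarrow> (\<exists>u1 u2. horizontal_with n a b g u1 u2))"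

definition lip_bounds :: "nat \<Rightarrow> (real \<Rightarrow> nat \<Rightarrow> real) \<Rightarrow> real set" where
  "lip_bounds n g = {L. 0 \<le> L \<and> (\<forall>s t. cc_dist n (g s) (g t) \<le> L * \<bar>s - t\<bar>)}"

definition cc_lipschitz :: "nat \<Rightarrow> (real \<Rightarrow> nat \<Rightarrow> real) \<Rightarrow> bool" where
  "cc_lipschitz n g \<longleftrightarrow> lip_bounds n g \<noteq> {}"

definition cc_Lip :: "nat \<Rightarrow> (real \<Rightarrow> nat \<Rightarrow> real) \<Rightarrow> real" where
  "cc_Lip n g = Inf (lip_bounds n g)"

definition horizontal_line :: "nat \<Rightarrow> (real \<Rightarrow> nat \<Rightarrow> real) \<Rightarrow> bool" where
  "horizontal_line n L \<longleftrightarrow>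
     (\<exists>q\<in>coords n. \<exists>V\<in>horizontal_layer n. L = (\<lambda>t. mult n q (scale t V)))"

text \<open>The intervals \<open>I 0, \<dots>, I (m - 1)\<close> cover the domain from left to right; neighbours may, but
  need not, share an end point.\<close>

definition joins_lines :: "nat \<Rightarrow> nat \<Rightarrow> (real \<Rightarrow> nat \<Rightarrow> real) \<Rightarrow> bool" where
  "joins_lines n N g \<longleftrightarrow>
     (\<exists>m\<le>N. \<exists>I :: nat \<Rightarrow> real set.
        (\<forall>k<m. is_interval (I k)) \<and> (\<Union>k<m. I k) = UNIV \<and>
        (\<forall>j k. j < k \<and> k < m \<longrightarrow> (\<forall>s\<in>I j. \<forall>t\<in>I k. s \<le> t)) \<and>
        (\<forall>k<m. \<exists>L. horizontal_line n L \<and> (\<forall>t\<in>I k. g t = L t)))"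


section \<open>Deformable directions\<close>

definition deformable :: "nat \<Rightarrow> (nat \<Rightarrow> real) \<Rightarrow> bool" where
  "deformable n E \<longleftrightarrow>
     E \<in> horizontal_layer n \<and> omega E = 1 \<and>
     (\<exists>(C::real) (N::nat) (D :: real \<Rightarrow> real).
        C > 0 \<and> N > 0 \<and> (\<forall>\<eta>>0. D \<eta> > 0) \<and>
        (\<forall>l \<eta> \<Delta> u. 0 < l \<and> l < 1 \<and> 0 < \<eta> \<and> 0 < \<Delta> \<and> \<Delta> < D \<eta> \<and>
             u \<in> coords n \<and> cc_norm n u \<le> 1 \<longrightarrow>
           (\<exists>g. cc_lipschitz n g \<and> horizontal_curve n g \<and> joins_lines n N g \<and>
              (\<forall>t. \<bar>t\<bar> \<ge> l \<longrightarrow> g t = scale t E) \<and>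
              g (inner_n n (dilation (\<Delta> * l) u) (left_inv_field n E origin)) = dilation (\<Delta> * l) u \<and>
              cc_Lip n g \<le> 1 + \<eta> * \<Delta> \<and>
              finite {t. \<not> (\<exists>w. ((\<lambda>s. proj (g s)) has_vector_derivative w) (at t) \<and>
                              norm (w - proj E) \<le> C * \<Delta>)})))"


section \<open>The group law has the prescribed Lie algebra\<close>

lemma bracket_X: "1 < i \<Longrightarrow> i < n \<Longrightarrow> bracket n (basis_vec i) (basis_vec 1) = basis_vec (i + 1)"
  by (auto simp: bracket_def basis_vec_def fun_eq_iff)

lemma bracket_X_top: "bracket n (basis_vec n) (basis_vec 1) = (\<lambda>i. 0)"
  by (auto simp: bracket_def basis_vec_def fun_eq_iff)

lemma bracket_X_ideal: "i \<noteq> 1 \<Longrightarrow> j \<noteq> 1 \<Longrightarrow> bracket n (basis_vec i) (basis_vec j) = (\<lambda>i. 0)"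
  by (auto simp: bracket_def basis_vec_def fun_eq_iff)

text \<open>The ideal \<open>V\<close> is identified with power series modulo the power \<open>n - 1\<close> of the variable, on
  which \<open>ad X_1\<close> is multiplication by minus the variable.\<close>

definition tail :: "(nat \<Rightarrow> real) \<Rightarrow> real fps" where
  "tail v = Abs_fps (\<lambda>k. v (k + 2))"

definition act :: "nat \<Rightarrow> real fps \<Rightarrow> (nat \<Rightarrow> real) \<Rightarrow> nat \<Rightarrow> real" where
  "act n f v = (\<lambda>i. if i \<in> {2..n} then fps_nth (f * tail v) (i - 2) else 0)"

definition phi :: "real \<Rightarrow> real fps" where
  "phi a = Abs_fps (\<lambda>k. (- a) ^ k / fact (Suc k))"

lemma ad_series_act: "ad_series n c a v = act n (Abs_fps (\<lambda>k. c k * (- a) ^ k)) v"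
proof
  fix i
  show "ad_series n c a v i = act n (Abs_fps (\<lambda>k. c k * (- a) ^ k)) v i"
  proof (cases "i \<in> {2..n}")
    case True
    have "(\<Sum>k\<le>i - 2. c k * (- a) ^ k * v (i - k)) =
          (\<Sum>k=0..i - 2. c k * (- a) ^ k * v (i - 2 - k + 2))"
      using True by (intro sum.cong) (auto simp: atLeast0AtMost intro!: arg_cong[of _ _ v])
    then show ?thesis using True by (simp add: ad_series_def act_def tail_def fps_mult_nth)
  qed (auto simp: ad_series_def act_def)
qed

lemma act_act: "act n f (act n g v) = act n (f * g) v"
proof
  fix i
  show "act n f (act n g v) i = act n (f * g) v i"
  proof (cases "i \<in> {2..n}")
    case True
    have "fps_nth (tail (act n g v)) k = fps_nth (g * tail v) k" if "k \<le> i - 2" for k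
      using that True by (auto simp: tail_def act_def)
    then have "fps_nth (f * tail (act n g v)) (i - 2) = fps_nth (f * (g * tail v)) (i - 2)"
      unfolding fps_mult_nth[of f] by (intro sum.cong) auto
    then show ?thesis using True by (simp add: act_def mult.assoc)
  qed (auto simp: act_def)
qed

lemma act_cong: "(\<And>i. i \<in> {2..n} \<Longrightarrow> v i = w i) \<Longrightarrow> act n f v = act n f w"
  by (auto simp: act_def tail_def fps_mult_nth fun_eq_iff intro!: sum.cong)

lemma act_add: "act n f (\<lambda>i. v i + w i) i = act n f v i + act n f w i"
  by (simp add: act_def tail_def fps_mult_nth algebra_simps sum.distrib)

lemma act_scale: "act n f (\<lambda>i. c * v i) i = c * act n f v i"
  by (simp add: act_def tail_def fps_mult_nth algebra_simps sum_distrib_left)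

lemma act_plus: "act n (f + g) v i = act n f v i + act n g v i"
  by (simp add: act_def algebra_simps)

lemma act_minus: "act n (f - g) v i = act n f v i - act n g v i"
  by (simp add: act_def algebra_simps)

lemma act_const: "act n (fps_const c * f) v i = c * act n f v i"
  by (simp add: act_def mult.assoc)

lemma act_one: "i \<in> {2..n} \<Longrightarrow> act n 1 v i = v i"
  by (auto simp: act_def tail_def intro!: arg_cong[of _ _ v])

lemma act_outside: "i \<notin> {2..n} \<Longrightarrow> act n f v i = 0"
  by (auto simp: act_def)

lemma sd_exp_act: "sd_exp n x = (\<lambda>i. if i = 1 then x 1 else act n (phi (x 1)) x i)"
  by (auto simp: sd_exp_def ad_series_act phi_def)

lemma sd_mult_act:
  "sd_mult n p q = (\<lambda>i. if i = 1 then p 1 + q 1 else p i + act n (fps_exp (- p 1)) q i)"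
  by (auto simp: sd_mult_def ad_series_act fps_exp_def)

lemma sd_1 [simp]: "sd_mult n p q (Suc 0) = p 1 + q 1" "sd_exp n x (Suc 0) = x 1"
  by (simp_all add: sd_mult_def sd_exp_def)

lemma phi_exp: "fps_const (- a) * fps_X * phi a = fps_exp (- a) - 1"
proof (rule fps_ext)
  fix k
  show "fps_nth (fps_const (- a) * fps_X * phi a) k = fps_nth (fps_exp (- a) - 1) k"
    by (cases k) (simp_all add: phi_def mult.assoc del: fact_Suc)
qed

lemma phi_inverse: "inverse (phi a) * phi a = 1" "phi a * inverse (phi a) = 1"
  by (simp_all add: inverse_mult_eq_1 inverse_mult_eq_1' phi_def)

lemma coords_eqI:
  assumes "x \<in> coords n" "y \<in> coords n" "x 1 = y 1" "\<And>i. i \<in> {2..n} \<Longrightarrow> x i = y i"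
  shows "x = y"
proof
  fix i
  consider "i = 1" | "i \<in> {2..n}" | "i \<notin> {1..n}" by fastforce
  then show "x i = y i" using assms by cases (auto simp: coords_def)
qed

lemma sd_exp_coords: "1 \<le> n \<Longrightarrow> sd_exp n x \<in> coords n"
  by (auto simp: sd_exp_act coords_def act_def)

lemma sd_mult_coords: "1 \<le> n \<Longrightarrow> p \<in> coords n \<Longrightarrow> sd_mult n p q \<in> coords n"
  by (auto simp: sd_mult_act coords_def act_def)

lemma sd_exp_bij:
  assumes "1 \<le> n"
  shows "bij_betw (sd_exp n) (coords n) (coords n)"
proof -
  define L where "L p = (\<lambda>i. if i = 1 then p 1 else act n (inverse (phi (p 1))) p i)" for p
  have [simp]: "L p \<in> coords n" for p using assms by (auto simp: L_def coords_def act_def)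
  have 1: "L (sd_exp n x) = x" if "x \<in> coords n" for x
  proof (rule coords_eqI[where n = n])
    fix i assume i: "i \<in> {2..n}"
    have "act n (inverse (phi (x 1))) (sd_exp n x) =
          act n (inverse (phi (x 1))) (act n (phi (x 1)) x)"
      by (rule act_cong) (auto simp: sd_exp_act)
    then show "L (sd_exp n x) i = x i"
      using i by (auto simp: L_def act_act phi_inverse act_one sd_exp_def)
  qed (use that in \<open>simp_all, simp add: L_def\<close>)
  have 2: "sd_exp n (L p) = p" if "p \<in> coords n" for p
  proof (rule coords_eqI[where n = n])
    fix i assume i: "i \<in> {2..n}"
    have "act n (phi (p 1)) (L p) = act n (phi (p 1)) (act n (inverse (phi (p 1))) p)"
      by (rule act_cong) (auto simp: L_def)
    then show "sd_exp n (L p) i = p i"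
      using i by (auto simp: L_def act_act phi_inverse act_one sd_exp_act)
  qed (use that assms in \<open>simp_all add: sd_exp_coords, simp add: L_def\<close>)
  show ?thesis
    by (rule bij_betw_byWitness[where f' = L]) (use 1 2 assms in \<open>auto simp: sd_exp_coords\<close>)
qed

lemma sd_mult_assoc:
  assumes "1 \<le> n" "p \<in> coords n" "q \<in> coords n" "r \<in> coords n"
  shows "sd_mult n (sd_mult n p q) r = sd_mult n p (sd_mult n q r)"
proof (rule coords_eqI[where n = n])
  fix i assume i: "i \<in> {2..n}"
  have *: "act n (fps_exp (- p 1)) (sd_mult n q r) =
        act n (fps_exp (- p 1)) (\<lambda>i. q i + act n (fps_exp (- q 1)) r i)"
    by (rule act_cong) (auto simp: sd_mult_act)
  have "fps_exp (- p 1) * fps_exp (- q 1) = fps_exp (- sd_mult n p q 1)"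
    by (simp add: sd_mult_def fps_exp_add_mult flip: fps_exp_add_mult)
  with * i show "sd_mult n (sd_mult n p q) r i = sd_mult n p (sd_mult n q r) i"
    unfolding sd_mult_act[of n p "sd_mult n q r"] sd_mult_act[of n "sd_mult n p q"]
    by (simp add: act_add act_act) (simp add: sd_mult_act)
qed (use assms in \<open>auto simp: sd_mult_coords\<close>)

lemma mult_coords: "1 \<le> n \<Longrightarrow> mult n x y \<in> coords n"
  using sd_exp_bij[of n] unfolding mult_def
  by (metis bij_betw_imp_surj_on inv_into_into sd_exp_coords sd_mult_coords)

lemma sd_exp_mult: "1 \<le> n \<Longrightarrow> sd_exp n (mult n x y) = sd_mult n (sd_exp n x) (sd_exp n y)"
  using sd_exp_bij[of n] unfolding mult_def
  by (metis bij_betw_imp_surj_on f_inv_into_f sd_exp_coords sd_mult_coords)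

lemma mult_eqI:
  assumes "1 \<le> n" "z \<in> coords n" "sd_mult n (sd_exp n x) (sd_exp n y) = sd_exp n z"
  shows "mult n x y = z"
  using assms sd_exp_bij[of n] by (simp add: mult_def bij_betw_def)

lemma scale_coords: "x \<in> coords n \<Longrightarrow> scale c x \<in> coords n"
  by (simp add: coords_def scale_def)

lemma origin_coords: "origin \<in> coords n"
  by (simp add: coords_def origin_def)

text \<open>Each \<open>t \<mapsto> scale t x\<close> is a one-parameter subgroup, i.e. \<open>scale t x\<close> is \<open>exp (t x)\<close>.\<close>

lemma filiform_one_param:
  assumes "1 \<le> n" "x \<in> coords n"
  shows "mult n (scale s x) (scale t x) = scale (s + t) x"
proof (rule mult_eqI)
  show "sd_mult n (sd_exp n (scale s x)) (sd_exp n (scale t x)) = sd_exp n (scale (s + t) x)"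
  proof (rule coords_eqI[where n = n])
    fix i assume i: "i \<in> {2..n}"
    define a where "a = x 1"
    have key: "fps_const s * phi (s * a) + fps_exp (- (s * a)) * (fps_const t * phi (t * a)) =
        fps_const (s + t) * phi ((s + t) * a)"
    proof (cases "a = 0")
      case True
      have "phi 0 = 1" by (rule fps_ext) (simp add: phi_def)
      with True show ?thesis by simp
    next
      case False
      have e: "fps_const (- a) * fps_X * (fps_const s * phi (s * a)) = fps_exp (- (s * a)) - 1" for s
      proof -
        have "fps_const (- a) * fps_X * (fps_const s * phi (s * a)) =
              (fps_const (- a) * fps_const s) * fps_X * phi (s * a)"
          by (simp only: mult_ac)
        also have "fps_const (- a) * fps_const s = fps_const (- (s * a))"
          by (simp add: mult.commute)
        finally show ?thesis by (simp only: phi_exp)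
      qed
      have "fps_const (- a) * fps_X * (fps_const s * phi (s * a) +
              fps_exp (- (s * a)) * (fps_const t * phi (t * a))) =
            fps_exp (- (s * a)) - 1 + fps_exp (- (s * a)) * (fps_exp (- (t * a)) - 1)"
      proof -
        have "Z * (P + F * Q) = Z * P + F * (Z * Q)" for Z P F Q :: "real fps"
          by (simp add: algebra_simps)
        then show ?thesis by (simp only: e)
      qed
      also have "\<dots> = fps_exp (- ((s + t) * a)) - 1"
        by (simp add: right_diff_distrib distrib_right flip: fps_exp_add_mult)
      also have "\<dots> = fps_const (- a) * fps_X * (fps_const (s + t) * phi ((s + t) * a))"
        by (simp only: e)
      finally have "fps_X * (fps_const s * phi (s * a) +
              fps_exp (- (s * a)) * (fps_const t * phi (t * a))) =
            fps_X * (fps_const (s + t) * phi ((s + t) * a))"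
        using False by (simp add: mult.assoc del: fps_const_neg)
      then show ?thesis by simp
    qed
    have "act n (fps_exp (- (s * a))) (sd_exp n (scale t x)) =
          act n (fps_exp (- (s * a))) (act n (phi (t * a)) (scale t x))"
      by (rule act_cong) (auto simp: sd_exp_act scale_def a_def)
    then have "sd_mult n (sd_exp n (scale s x)) (sd_exp n (scale t x)) i =
        s * act n (phi (s * a)) x i + t * act n (fps_exp (- (s * a)) * phi (t * a)) x i"
      using i by (auto simp: sd_mult_act act_act) (auto simp: sd_exp_act scale_def a_def act_scale)
    also have "\<dots> = act n (fps_const s * phi (s * a) +
        fps_exp (- (s * a)) * (fps_const t * phi (t * a))) x i"
      by (simp add: act_plus mult.left_commute[of _ "fps_const _"] act_const)
    also have "\<dots> = sd_exp n (scale (s + t) x) i"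
      unfolding key using i by (auto simp: act_const sd_exp_act scale_def a_def act_scale)
    finally show "sd_mult n (sd_exp n (scale s x)) (sd_exp n (scale t x)) i =
        sd_exp n (scale (s + t) x) i" .
  qed (use assms in \<open>auto simp: sd_mult_coords sd_exp_coords scale_def algebra_simps\<close>)
qed (use assms in \<open>auto simp: scale_coords\<close>)

lemma filiform_group:
  assumes "1 \<le> n" "x \<in> coords n" "y \<in> coords n" "z \<in> coords n"
  shows "mult n (mult n x y) z = mult n x (mult n y z)"
    and "mult n origin x = x" and "mult n x origin = x"
    and "mult n (scale (-1) x) x = origin" and "mult n x (scale (-1) x) = origin"
proof -
  have [simp]: "sd_exp n origin = origin"
    by (auto simp: sd_exp_def ad_series_def origin_def fun_eq_iff)
  show "mult n (mult n x y) z = mult n x (mult n y z)"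
    by (rule mult_eqI) (use assms in \<open>simp_all add: mult_coords sd_exp_mult sd_mult_assoc sd_exp_coords\<close>)
  have "sd_mult n origin p = p" if "p \<in> coords n" for p
    by (rule coords_eqI[where n = n])
       (use that assms in \<open>simp_all add: sd_mult_coords origin_coords\<close>,
        simp_all add: sd_mult_act origin_def act_one)
  then show "mult n origin x = x"
    by (intro mult_eqI) (use assms in \<open>simp_all add: sd_exp_coords\<close>)
  have "sd_mult n p origin = p" for p
    by (auto simp: sd_mult_def ad_series_def origin_def fun_eq_iff)
  then show "mult n x origin = x"
    by (intro mult_eqI) (use assms in simp_all)
  have s: "scale 1 x = x" "scale 0 x = origin" by (auto simp: scale_def origin_def)
  show "mult n (scale (-1) x) x = origin"
    using filiform_one_param[OF assms(1,2), of "-1" 1] by (simp add: s)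
  show "mult n x (scale (-1) x) = origin"
    using filiform_one_param[OF assms(1,2), of 1 "-1"] by (simp add: s)
qed

text \<open>The adjoint action of \<open>exp x\<close> is \<open>e^(ad x)\<close> for the bracket above, so the Lie algebra of the
  group is \<open>bracket n\<close>.\<close>

lemma filiform_Ad:
  assumes n: "1 \<le> n" and x: "x \<in> coords n" and y: "y \<in> coords n"
  shows "mult n (mult n x y) (scale (-1) x) =
           (\<lambda>i. \<Sum>k<n. (bracket n x ^^ k) y i / fact k)"
proof -
  define a b where "a = x 1" and "b = y 1"
  define w where "w = (\<lambda>i. \<Sum>k<n. (bracket n x ^^ k) y i / fact k)"
  define v where "v = (\<lambda>i. b * x i - a * y i)"
  have shift: "act n fps_X u i = (if i \<in> {3..n} then u (i - 1) else 0)" for u i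
  proof (cases "i \<in> {3..n}")
    case True
    then have "i - 2 - 1 + 2 = i - 1" "i - 2 \<noteq> 0" "i - 3 + 2 = i - 1" by auto
    then show ?thesis using True by (simp add: act_def tail_def numeral_eq_Suc)
  next
    case False
    then have "i = 2 \<or> i \<notin> {2..n}" by auto
    with False show ?thesis by (auto simp: act_def)
  qed
  have br1: "(bracket n x ^^ Suc k) y 1 = 0" for k
    by (simp add: bracket_def)
  have br: "(bracket n x ^^ Suc k) y = act n (fps_const ((- a) ^ k) * fps_X ^ Suc k) v" for k
  proof (induction k)
    case 0
    show ?case by (auto simp: fun_eq_iff shift bracket_def v_def a_def b_def)
  next
    case (Suc k)
    have "(bracket n x ^^ Suc (Suc k)) y = bracket n x ((bracket n x ^^ Suc k) y)" by simp
    also have "\<dots> = (\<lambda>i. - a * act n fps_X ((bracket n x ^^ Suc k) y) i)"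
      using br1[of k] by (auto simp: fun_eq_iff shift bracket_def[of n x "(bracket n x ^^ Suc k) y"] a_def
          simp del: funpow.simps)
    also have "\<dots> = act n (fps_const ((- a) ^ Suc k) * fps_X ^ Suc (Suc k)) v"
      unfolding Suc act_act
      by (simp add: fun_eq_iff mult_ac flip: act_const)
         (simp add: mult.assoc[symmetric] mult.commute)
    finally show ?case .
  qed
  have w1: "w 1 = b"
  proof -
    have "(bracket n x ^^ k) y 1 / fact k = (if k = 0 then b else 0)" for k
      using br1[of "k - 1"] by (cases k) (auto simp: b_def simp del: funpow.simps)
    then show ?thesis using n unfolding w_def by (simp add: sum.delta)
  qed
  have wi: "w i = y i + act n (fps_X * phi a) v i" if i: "i \<in> {2..n}" for i
  proof -
    have "w i = y i + (\<Sum>k<n - 1. (bracket n x ^^ Suc k) y i / fact (Suc k))"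
    proof -
      obtain m where m: "n = Suc m" using n by (cases n) auto
      show ?thesis unfolding w_def m by (subst sum.lessThan_Suc_shift) simp
    qed
    also have "(\<Sum>k<n - 1. (bracket n x ^^ Suc k) y i / fact (Suc k)) =
        (\<Sum>k<n - 1. act n (fps_const ((- a) ^ k / fact (Suc k)) * fps_X ^ Suc k) v i)"
      unfolding br act_const by simp
    also have "\<dots> = fps_nth ((\<Sum>k<n - 1. fps_const ((- a) ^ k / fact (Suc k)) * fps_X ^ Suc k) * tail v) (i - 2)"
      using i by (simp add: act_def sum_distrib_right fps_sum_nth)
    also have "\<dots> = fps_nth ((fps_X * phi a) * tail v) (i - 2)"
    proof -
      have "fps_nth (\<Sum>k<n - 1. fps_const ((- a) ^ k / fact (Suc k)) * fps_X ^ Suc k) j =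
            fps_nth (fps_X * phi a) j" if "j \<le> i - 2" for j
      proof -
        have "fps_nth (\<Sum>k<n - 1. fps_const ((- a) ^ k / fact (Suc k)) * fps_X ^ Suc k) j =
            (\<Sum>k<n - 1. if k = j - 1 \<and> j \<noteq> 0 then (- a) ^ k / fact (Suc k) else 0)"
          unfolding fps_sum_nth
          by (intro sum.cong refl) (auto simp: fps_X_power_nth simp del: power_Suc fact_Suc)
        also have "\<dots> = fps_nth (fps_X * phi a) j"
        proof (cases j)
          case (Suc j')
          with that i have "j' < n - 1" by auto
          with Suc show ?thesis by (simp add: phi_def sum.delta del: fact_Suc)
        qed simp
        finally show ?thesis .
      qed
      then show ?thesis unfolding fps_mult_nth[of _ "tail v"] by (intro sum.cong) auto
    qed
    finally show ?thesis using i by (simp add: act_def)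
  qed
  have w_coords: "w \<in> coords n"
  proof -
    have "(bracket n x ^^ k) y i = 0" if "i \<notin> {1..n}" for k i
      using that y by (cases k) (auto simp: coords_def bracket_def)
    then show ?thesis by (simp add: w_def coords_def)
  qed
  have "sd_mult n (sd_exp n w) (sd_exp n x) = sd_mult n (sd_exp n x) (sd_exp n y)"
  proof (rule coords_eqI[where n = n])
    fix i assume i: "i \<in> {2..n}"
    have E: "act n (fps_exp (- c)) (sd_exp n z) = act n (fps_exp (- c) * phi (z 1)) z" for c z
      unfolding act_act[symmetric] by (rule act_cong) (auto simp: sd_exp_act)
    have "act n (phi b) w = act n (phi b) (\<lambda>i. y i + act n (fps_X * phi a) v i)"
      by (rule act_cong) (simp add: wi)
    then have "act n (phi b) w i =
        act n (phi b) y i + act n (phi b * (fps_X * phi a)) (\<lambda>i. b * x i + (- a) * y i) i"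
      by (simp add: act_add act_act v_def)
    also have "\<dots> = act n (phi b + fps_const (- a) * fps_X * phi a * phi b) y i -
        act n (fps_const (- b) * fps_X * phi b * phi a) x i"
      unfolding act_add act_scale act_plus
      by (simp add: act_const mult.assoc mult.left_commute[of "phi b"] mult.commute[of "phi b"]
          del: fps_const_neg)
    also have "\<dots> = act n (fps_exp (- a) * phi b) y i - act n (fps_exp (- b) * phi a - phi a) x i"
      unfolding phi_exp by (simp add: algebra_simps)
    finally have "act n (phi b) w i + act n (fps_exp (- b) * phi a) x i =
        act n (phi a) x i + act n (fps_exp (- a) * phi b) y i"
      unfolding act_minus by simp
    then show "sd_mult n (sd_exp n w) (sd_exp n x) i = sd_mult n (sd_exp n x) (sd_exp n y) i"
      using i w1 unfolding sd_mult_act by (auto simp: E) (auto simp: sd_exp_act E a_def b_def)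
  qed (use n w1 in \<open>auto simp: sd_mult_coords sd_exp_coords b_def\<close>)
  then have "mult n w x = mult n x y" by (simp add: mult_def)
  then have "mult n (mult n x y) (scale (-1) x) = mult n w (mult n x (scale (-1) x))"
    using filiform_group(1)[OF n w_coords x scale_coords[OF x]] by simp
  also have "\<dots> = w" using filiform_group(3,5)[OF n] w_coords x by simp
  finally show ?thesis by (simp add: w_def)
qed

lemma left_inv_field_origin:
  assumes "1 \<le> n" "E \<in> coords n"
  shows "left_inv_field n E origin = E"
proof
  fix i
  have "mult n origin (scale t E) i = t * E i" for t
    using filiform_group(2)[OF assms(1) scale_coords[OF assms(2), of t]] assms
    by (simp add: scale_def origin_coords)
  moreover have "((\<lambda>t. t * E i) has_field_derivative E i) (at 0)"
    by (auto intro!: derivative_eq_intros)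
  ultimately show "left_inv_field n E origin i = E i"
    by (simp add: left_inv_field_def DERIV_imp_deriv)
qed

end

theory Submission
  imports Defs
begin

text \<open>Write a point of \<open>E_n\<close> in the semidirect product coordinates \<open>(a, v_2, \<dots>, v_n)\<close>, that is, apply
  \<^const>\<open>sd_exp\<close>.  A horizontal curve with controls \<open>u_1, u_2\<close> then satisfies
  \<open>a' = u_1\<close>, \<open>v_2' = u_2\<close>, \<open>v_3' = - u_2 a\<close> and \<open>v_4' = u_2 a\<^sup>2 / 2\<close>.  Let \<open>E = \<sigma> X_2\<close> with
  \<open>\<sigma> = 1\<close> or \<open>\<sigma> = -1\<close>.

  For \<open>n \<ge> 4\<close> the last equation is an obstruction.  If the direction of the curve is close to \<open>E\<close>, then
  \<open>u_2\<close> has the sign of \<open>\<sigma>\<close>, so \<open>\<sigma> v_4\<close> is nondecreasing.  It vanishes at both ends of the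
  deformed piece because the curve is there on the line \<open>exp(t E)\<close>.  Hence it is constant, and therefore
  \<open>a = 0\<close> throughout (\<open>nearly_vertical_rigid\<close>).  Such a curve misses the dilates of \<open>X_1\<close>.

  For \<open>n \<le> 3\<close> the only constraint is the one on \<open>v_3\<close>, the signed area under the graph of \<open>a\<close>, and
  it can be met by letting \<open>a\<close> change sign.  Keep \<open>u_2 = \<sigma>\<close> and let \<open>a\<close> be a broken line that
  starts at \<open>0\<close>, has the prescribed value and the prescribed area at the time \<open>\<zeta>\<close>, and returns to value and
  area \<open>0\<close> (\<open>deformation_slopes_exist\<close>).  Its slopes are at most \<open>36 \<Delta>\<close>, so the speed is at most
  \<open>sqrt (1 + (36 \<Delta>)\<^sup>2)\<close>: the cost of the deformation is quadratic in \<open>\<Delta>\<close>, hence below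
  \<open>\<eta> \<Delta>\<close> for small \<open>\<Delta>\<close>.

  The slope estimate presupposes bounds on the coordinates of a point \<open>u\<close> with \<open>d(u) \<le> 1\<close>
  (\<open>cc_norm_le_1_imp\<close>).  They follow by integrating the horizontality equation along an almost shortest
  curve, which requires the fundamental theorem of calculus for absolutely continuous functions
  (\<open>abs_continuous_has_integral\<close>).\<close>

section \<open>Absolutely continuous functions\<close>

lemma abs_continuousE:
  assumes "abs_continuous f a b" "0 < e"
  obtains d where "d > 0" and "\<And>(m::nat) l r.
      \<lbrakk>\<forall>k<m. a \<le> l k \<and> l k \<le> r k \<and> r k \<le> b;
       \<forall>j<m. \<forall>k<m. j \<noteq> k \<longrightarrow> {l j<..<r j} \<inter> {l k<..<r k} = {};
       (\<Sum>k<m. r k - l k) < d\<rbrakk> \<Longrightarrow> (\<Sum>k<m. \<bar>f (r k) - f (l k)\<bar>) < e"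
proof -
  obtain d where d: "d > 0" "\<forall>(m::nat) l r.
        (\<forall>k<m. a \<le> l k \<and> l k \<le> r k \<and> r k \<le> b) \<and>
        (\<forall>j<m. \<forall>k<m. j \<noteq> k \<longrightarrow> {l j<..<r j} \<inter> {l k<..<r k} = {}) \<and>
        (\<Sum>k<m. r k - l k) < d
        \<longrightarrow> (\<Sum>k<m. \<bar>f (r k) - f (l k)\<bar>) < e"
    using assms(1)[unfolded abs_continuous_def, THEN spec, THEN mp, OF assms(2)] by (elim exE conjE)
  show thesis
    by (rule that[OF d(1)], rule d(2)[THEN spec, THEN spec, THEN spec, THEN mp]) (intro conjI)
qed

lemma abs_continuous_imp_continuous_on:
  assumes "abs_continuous f a b"
  shows "continuous_on {a..b} f"
  unfolding continuous_on_iff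
proof (intro ballI allI impI)
  fix x e :: real
  assume x: "x \<in> {a..b}" and "0 < e"
  obtain d where "d > 0" and d: "\<And>(m::nat) l r.
      \<lbrakk>\<forall>k<m. a \<le> l k \<and> l k \<le> r k \<and> r k \<le> b;
       \<forall>j<m. \<forall>k<m. j \<noteq> k \<longrightarrow> {l j<..<r j} \<inter> {l k<..<r k} = {};
       (\<Sum>k<m. r k - l k) < d\<rbrakk> \<Longrightarrow> (\<Sum>k<m. \<bar>f (r k) - f (l k)\<bar>) < e"
    by (fact abs_continuousE[OF assms \<open>0 < e\<close>])
  have "dist (f y) (f x) < e" if y: "y \<in> {a..b}" "dist y x < d" for y
  proof (cases "x \<le> y")
    case True
    then show ?thesis using d[of 1 "\<lambda>_. x" "\<lambda>_. y"] x y by (auto simp: dist_real_def)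
  next
    case False
    then show ?thesis using d[of 1 "\<lambda>_. y" "\<lambda>_. x"] x y by (auto simp: dist_real_def)
  qed
  with \<open>d > 0\<close> show "\<exists>d>0. \<forall>y\<in>{a..b}. dist y x < d \<longrightarrow> dist (f y) (f x) < e"
    by blast
qed

text \<open>Such a function is Lipschitz, because its increments are integrals of the derivative.\<close>

lemma bounded_derivative_imp_abs_continuous:
  fixes f f' :: "real \<Rightarrow> real"
  assumes cont: "continuous_on {a..b} f" and S: "finite S"
    and der: "\<And>t. t \<in> {a<..<b} - S \<Longrightarrow> (f has_real_derivative f' t) (at t)"
    and bd: "\<And>t. t \<in> {a<..<b} - S \<Longrightarrow> \<bar>f' t\<bar> \<le> B"
  shows "abs_continuous f a b"
proof -
  define B' where "B' = max B 1"
  have lip: "\<bar>f s - f r\<bar> \<le> B' * (s - r)" if "a \<le> r" "r \<le> s" "s \<le> b" for r s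
  proof -
    have "(f' has_integral f s - f r) {r..s}"
      by (rule fundamental_theorem_of_calculus_interior_strong[OF S that(2)])
         (use der that cont in \<open>auto simp: has_real_derivative_iff_has_vector_derivative[symmetric]
            intro: continuous_on_subset\<close>)
    then have "norm (f s - f r) \<le> B' * measure lborel (cbox r s)"
      using bd that
      by (intro has_integral_bound_spike_finite[of B' "insert r (insert s S)" f'])
         (auto simp: S B'_def intro!: max.coboundedI1)
    then show ?thesis using that by simp
  qed
  show ?thesis
    unfolding abs_continuous_def
  proof (intro allI impI)
    fix e :: real assume "e > 0"
    show "\<exists>d>0. \<forall>(m::nat) l r.
        (\<forall>k<m. a \<le> l k \<and> l k \<le> r k \<and> r k \<le> b) \<and>
        (\<forall>j<m. \<forall>k<m. j \<noteq> k \<longrightarrow> {l j<..<r j} \<inter> {l k<..<r k} = {}) \<and>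
        (\<Sum>k<m. r k - l k) < d
        \<longrightarrow> (\<Sum>k<m. \<bar>f (r k) - f (l k)\<bar>) < e"
    proof (intro exI[of _ "e / B'"] conjI allI impI; (elim conjE)?)
      fix m and l r :: "nat \<Rightarrow> real"
      assume lr: "\<forall>k<m. a \<le> l k \<and> l k \<le> r k \<and> r k \<le> b" and s: "(\<Sum>k<m. r k - l k) < e / B'"
      have "(\<Sum>k<m. \<bar>f (r k) - f (l k)\<bar>) \<le> (\<Sum>k<m. B' * (r k - l k))"
        by (intro sum_mono lip) (use lr in auto)
      also have "\<dots> < e"
        using s by (simp add: sum_distrib_left[symmetric] B'_def pos_less_divide_eq mult.commute)
      finally show "(\<Sum>k<m. \<bar>f (r k) - f (l k)\<bar>) < e" .
    qed (use \<open>e > 0\<close> in \<open>auto simp: B'_def\<close>)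
  qed
qed

lemma negligible_outer_open:
  assumes "negligible (N :: real set)" "d > 0"
  obtains U where "open U" "N \<subseteq> U" "U \<in> lmeasurable" "measure lebesgue U < d"
proof -
  have N: "N \<in> sets lebesgue" "N \<in> null_sets lebesgue"
    using assms(1) by (auto simp: negligible_imp_sets negligible_iff_null_sets)
  obtain U where U: "open U" "N \<subseteq> U" "U - N \<in> lmeasurable" "emeasure lebesgue (U - N) < ennreal d"
    using sets_lebesgue_outer_open[OF N(1) assms(2)] by metis
  have "emeasure lebesgue U = emeasure lebesgue (U - N)"
    using U(1) N(2) by (subst emeasure_Diff_null_set) auto
  with U(4) have "emeasure lebesgue U < ennreal d" by simp
  moreover from this have "U \<in> lmeasurable"
    using U(1) by (intro fmeasurableI) (auto intro: order.strict_trans)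
  ultimately have "U \<in> lmeasurable" "measure lebesgue U < d"
    by (auto simp: emeasure_eq_measure2 ennreal_less_iff)
  with U that show ?thesis by blast
qed

text \<open>The gauge integral reduces this to Riemann sums.  Tags outside the null set \<open>N\<close> are controlled by the
  derivative, as in the classical fundamental theorem.  The gauge forces intervals with tags in \<open>N\<close> into an open
  set of measure less than \<open>d\<close>, where absolute continuity bounds the total increment of \<open>f\<close>.\<close>

lemma abs_continuous_has_integral:
  fixes f g :: "real \<Rightarrow> real"
  assumes ac: "abs_continuous f a b" and ab: "a \<le> b" and N: "negligible N"
    and der: "\<And>t. t \<in> {a..b} - N \<Longrightarrow> (f has_real_derivative g t) (at t within {a..b})"
  shows "(g has_integral f b - f a) {a..b}"
proof -
  define h where "h t = (if t \<in> N then 0 else g t)" for t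
  have "(h has_integral f b - f a) {a..b}"
    unfolding has_integral_real
  proof (intro allI impI)
    fix e :: real assume "e > 0"
    then have "e / 2 > 0" by simp
    obtain d where "d > 0" and d: "\<And>(m::nat) l r.
      \<lbrakk>\<forall>k<m. a \<le> l k \<and> l k \<le> r k \<and> r k \<le> b;
       \<forall>j<m. \<forall>k<m. j \<noteq> k \<longrightarrow> {l j<..<r j} \<inter> {l k<..<r k} = {};
       (\<Sum>k<m. r k - l k) < d\<rbrakk> \<Longrightarrow> (\<Sum>k<m. \<bar>f (r k) - f (l k)\<bar>) < e / 2"
      by (fact abs_continuousE[OF ac \<open>e / 2 > 0\<close>])
    obtain U where U: "open U" "N \<subseteq> U" "U \<in> lmeasurable" "measure lebesgue U < d"
      using negligible_outer_open[OF N \<open>d > 0\<close>] by blast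
    \<comment> \<open>half of the error is left for the tags in \<open>N\<close>; the summand 1 keeps \<open>c\<close> defined for \<open>a = b\<close>\<close>
    define c where "c = e / (2 * (b - a + 1))"
    have "c > 0" using \<open>e > 0\<close> ab by (simp add: c_def)
    have "\<exists>r>0. x \<in> {a..b} - N \<longrightarrow> (\<forall>y\<in>{a..b}. norm (y - x) < r \<longrightarrow>
        norm (f y - f x - (y - x) * g x) \<le> c * norm (y - x))" for x
    proof (cases "x \<in> {a..b} - N")
      case True
      from der[OF this] \<open>c > 0\<close> show ?thesis
        unfolding has_field_derivative_def has_derivative_within_alt
        by (auto simp: mult.commute)
    qed (auto intro: exI[of _ 1])
    then obtain r where r: "\<And>x. r x > 0" "\<And>x y. x \<in> {a..b} - N \<Longrightarrow> y \<in> {a..b} \<Longrightarrow>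
        norm (y - x) < r x \<Longrightarrow> norm (f y - f x - (y - x) * g x) \<le> c * norm (y - x)"
      by metis
    define G where "G x = (if x \<in> N then U else ball x (r x))" for x
    have "gauge G" using U r(1) by (auto simp: gauge_def G_def)
    moreover have "norm ((\<Sum>(x,K)\<in>p. measure lborel K *\<^sub>R h x) - (f b - f a)) < e"
      if p: "p tagged_division_of {a..b}" and fine: "G fine p" for p
    proof -
      note pD = tagged_division_ofD[OF p]
      have K: "K = {Inf K..Sup K} \<and> a \<le> Inf K \<and> Inf K \<le> x \<and> x \<le> Sup K \<and> Sup K \<le> b"
        if "(x, K) \<in> p" for x K
      proof -
        obtain u v where uv: "K = {u..v}" using pD(4) \<open>(x, K) \<in> p\<close> by (metis box_real(2))
        then show ?thesis using pD(2,3)[OF \<open>(x, K) \<in> p\<close>] by auto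
      qed
      have cont: "measure lborel K = Sup K - Inf K" if "(x, K) \<in> p" for x K
        using K[OF that] by (metis content_real order.trans)
      define t where "t = (\<lambda>(x, K). measure lborel K *\<^sub>R h x - (f (Sup K) - f (Inf K)))"
      \<comment> \<open>the part of the division whose tags lie in the null set\<close>
      define q where "q = {(x, K) \<in> p. x \<in> N}"
      have q: "q \<subseteq> p" "finite q" using pD(1) by (auto simp: q_def intro: finite_subset)
      have eq: "(\<Sum>(x,K)\<in>p. measure lborel K *\<^sub>R h x) - (f b - f a) = sum t p"
        using additive_tagged_division_1[OF ab p, of f]
        by (simp add: t_def sum_subtractf case_prod_unfold)
      have "sum t p = sum t (p - q) + sum t q"
        using q pD(1) by (simp add: sum.subset_diff)
      moreover have "norm (sum t (p - q)) \<le> c * (b - a)"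
      proof -
        have "norm (sum t (p - q)) \<le> (\<Sum>(x,K)\<in>p - q. c * (Sup K - Inf K))"
        proof (rule sum_norm_le)
          fix z assume z: "z \<in> p - q"
          obtain x K where zz: "z = (x, K)" by fastforce
          have xK: "(x, K) \<in> p" "x \<notin> N" using z zz by (auto simp: q_def)
          note k = K[OF xK(1)]
          have "K \<subseteq> ball x (r x)" using fine xK by (fastforce simp: fine_def G_def)
          moreover have "Inf K \<in> K" "Sup K \<in> K"
            using k by (metis atLeastAtMost_iff order.refl order.trans)+
          ultimately have "Inf K \<in> ball x (r x)" "Sup K \<in> ball x (r x)" by auto
          then have "\<bar>f (Inf K) - f x - (Inf K - x) * g x\<bar> \<le> c * (x - Inf K)"
            "\<bar>f (Sup K) - f x - (Sup K - x) * g x\<bar> \<le> c * (Sup K - x)"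
            using k r(2)[of x "Inf K"] r(2)[of x "Sup K"] xK by (auto simp: dist_real_def)
          moreover have "(f (Inf K) - f x - (Inf K - x) * g x) - (f (Sup K) - f x - (Sup K - x) * g x)
             = t z"
            using xK by (simp add: t_def zz h_def cont[OF xK(1)] algebra_simps)
          moreover have "c * (x - Inf K) + c * (Sup K - x) = c * (Sup K - Inf K)"
            by (simp add: algebra_simps)
          ultimately show "norm (t z) \<le> (case z of (x, K) \<Rightarrow> c * (Sup K - Inf K))"
            unfolding zz real_norm_def prod.case by linarith
        qed
        also have "\<dots> \<le> (\<Sum>(x,K)\<in>p. c * (Sup K - Inf K))"
          by (rule sum_mono2) (use pD(1) \<open>c > 0\<close> K in \<open>force+\<close>)
        also have "\<dots> = c * (b - a)"
          using additive_tagged_division_1[OF ab p, of "\<lambda>x. x"]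
          by (simp add: sum_distrib_left[symmetric] case_prod_unfold)
        finally show ?thesis .
      qed
      moreover have "norm (sum t q) < e / 2"
      proof -
        obtain z where z: "bij_betw z {0..<card q} q"
          using ex_bij_betw_nat_finite[OF q(2)] by blast
        have zq: "z k \<in> q" if "k < card q" for k
          using z that by (auto simp: bij_betw_def)
        have reindex: "(\<Sum>k<card q. F (z k)) = sum F q" for F :: "real \<times> real set \<Rightarrow> real"
          using sum.reindex_bij_betw[OF z] by (simp add: lessThan_atLeast0)
        define l where "l k = Inf (snd (z k))" for k
        define s where "s k = Sup (snd (z k))" for k
        have z_eq: "(fst (z k), snd (z k)) \<in> p" if "k < card q" for k using zq[OF that] q by auto
        have int: "interior (snd (z k)) = {l k<..<s k}" if "k < card q" for k
          using K[OF z_eq[OF that]] unfolding l_def s_def by (metis interior_atLeastAtMost_real)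
        have ls: "\<forall>k<card q. a \<le> l k \<and> l k \<le> s k \<and> s k \<le> b"
          using K[OF z_eq] by (fastforce simp: l_def s_def)
        have disj: "\<forall>j<card q. \<forall>k<card q. j \<noteq> k \<longrightarrow> {l j<..<s j} \<inter> {l k<..<s k} = {}"
        proof (intro allI impI)
          fix j k assume jk: "j < card q" "k < card q" "j \<noteq> k"
          then have "z j \<noteq> z k" using z by (auto simp: bij_betw_def inj_on_def)
          then show "{l j<..<s j} \<inter> {l k<..<s k} = {}"
            using pD(5)[OF z_eq[OF jk(1)] z_eq[OF jk(2)]] jk by (auto simp: int prod_eq_iff)
        qed
        have "(\<Sum>k<card q. s k - l k) = (\<Sum>k<card q. measure lebesgue {l k<..<s k})"
          using ls by (intro sum.cong) auto
        also have "\<dots> = measure lebesgue (\<Union>k<card q. {l k<..<s k})"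
        proof (rule measure_finite_Union[symmetric])
          show "disjoint_family_on (\<lambda>k. {l k<..<s k}) {..<card q}"
            unfolding disjoint_family_on_def using disj by blast
          show "emeasure lebesgue {l k<..<s k} \<noteq> \<infinity>" if "k \<in> {..<card q}" for k
            using ls that by simp
        qed auto
        also have "\<dots> \<le> measure lebesgue U"
        proof (rule measure_mono_fmeasurable)
          have inside: "snd (z k) \<subseteq> U" if "k < card q" for k
          proof -
            have "snd (z k) \<subseteq> G (fst (z k))" using bspec[OF fine[unfolded fine_def] z_eq[OF that]] by (simp add: case_prod_unfold)
            then show ?thesis using zq[OF that] by (auto simp: q_def G_def)
          qed
          have "{l k<..<s k} \<subseteq> U" if "k < card q" for k
            unfolding int[OF that, symmetric] by (rule subset_trans[OF interior_subset inside[OF that]])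
          then show "(\<Union>k<card q. {l k<..<s k}) \<subseteq> U"
            by auto
        qed (use U in auto)
        finally have "(\<Sum>k<card q. s k - l k) < d" using U(4) by linarith
        with ls disj have less: "(\<Sum>k<card q. \<bar>f (s k) - f (l k)\<bar>) < e / 2" by (rule d)
        have "norm (sum t q) \<le> (\<Sum>w\<in>q. \<bar>f (Sup (snd w)) - f (Inf (snd w))\<bar>)"
          by (rule sum_norm_le) (auto simp: t_def q_def h_def abs_minus_commute)
        also have "\<dots> = (\<Sum>k<card q. \<bar>f (s k) - f (l k)\<bar>)"
          unfolding l_def s_def by (rule reindex[symmetric])
        finally show ?thesis using less by linarith
      qed
      moreover have "c * (b - a) \<le> e / 2"
        using \<open>e > 0\<close> ab by (simp add: c_def field_simps)
      ultimately show ?thesis unfolding eq real_norm_def by linarith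
    qed
    ultimately show "\<exists>\<gamma>. gauge \<gamma> \<and> (\<forall>\<D>. \<D> tagged_division_of {a..b} \<and> \<gamma> fine \<D> \<longrightarrow>
        norm ((\<Sum>(x,k)\<in>\<D>. measure lborel k *\<^sub>R h x) - (f b - f a)) < e)"
      by (intro exI[of _ G]) simp
  qed
  from has_integral_spike[OF N _ this, of g] show ?thesis by (auto simp: h_def)
qed

section \<open>Horizontal curves and their length\<close>

text \<open>All curves constructed below are piecewise smooth; for them the almost everywhere conditions reduce to
  conditions off a finite set.\<close>

lemma horizontal_withI:
  assumes ab: "a \<le> b" and co: "\<And>t. t \<in> {a..b} \<Longrightarrow> \<gamma> t \<in> coords n"
    and int: "set_integrable lebesgue {a..b} u1" "set_integrable lebesgue {a..b} u2"
    and S: "finite S"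
    and cont: "\<And>i. i \<in> {1..n} \<Longrightarrow> continuous_on {a..b} (\<lambda>t. \<gamma> t i)"
    and D: "\<And>t i. t \<in> {a..b} - S \<Longrightarrow> i \<in> {1..n} \<Longrightarrow>
      u1 t * left_inv_field n (basis_vec 1) (\<gamma> t) i + u2 t * left_inv_field n (basis_vec 2) (\<gamma> t) i = D t i"
    and der: "\<And>t i. t \<in> {a..b} - S \<Longrightarrow> i \<in> {1..n} \<Longrightarrow>
      ((\<lambda>s. \<gamma> s i) has_real_derivative D t i) (at t)"
    and bd: "\<And>i. i \<in> {1..n} \<Longrightarrow> \<exists>B. \<forall>t\<in>{a..b}. \<bar>D t i\<bar> \<le> B"
  shows "horizontal_with n a b \<gamma> u1 u2"
  unfolding horizontal_with_def
proof (intro conjI ballI ab co int)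
  fix i assume i: "i \<in> {1..n}"
  obtain B where "\<forall>t\<in>{a..b}. \<bar>D t i\<bar> \<le> B" using bd[OF i] ..
  then show "abs_continuous (\<lambda>t. \<gamma> t i) a b"
    by (intro bounded_derivative_imp_abs_continuous[OF cont[OF i] S, of "\<lambda>t. D t i" B])
       (use der i in auto)
next
  have "AE t in lebesgue. t \<notin> S"
    using S by (intro AE_not_in) (auto simp: negligible_iff_null_sets[symmetric] intro: negligible_finite)
  then show "AE t in lebesgue. t \<in> {a..b} \<longrightarrow>
        (\<forall>i\<in>{1..n}. ((\<lambda>s. \<gamma> s i) has_real_derivative
            (u1 t * left_inv_field n (basis_vec 1) (\<gamma> t) i + u2 t * left_inv_field n (basis_vec 2) (\<gamma> t) i))
          (at t within {a..b}))"
    by eventually_elim (use D der in \<open>auto intro: has_field_derivative_at_within\<close>)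
qed

lemma set_integrable_norm_Pair:
  assumes "set_integrable lebesgue {a..b} u1" "set_integrable lebesgue {a..b} u2"
  shows "set_integrable lebesgue {a..b::real} (\<lambda>t. norm (u1 t :: real, u2 t :: real))"
proof -
  have "set_integrable lebesgue {a..b} (\<lambda>t. u1 t *\<^sub>R (1::real, 0::real) + u2 t *\<^sub>R (0, 1))"
    using assms by (intro set_integral_add set_integrable_scaleR_left)
  then show ?thesis by (intro set_integrable_norm) simp
qed

lemma curve_length_integral:
  assumes "set_integrable lebesgue {a..b} u1" "set_integrable lebesgue {a..b} u2"
  shows "(\<lambda>t. norm (u1 t, u2 t)) integrable_on {a..b}"
    and "curve_length a b u1 u2 = integral {a..b} (\<lambda>t. norm (u1 t, u2 t))"
  using set_lebesgue_integral_eq_integral[OF set_integrable_norm_Pair[OF assms]]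
  by (simp_all add: curve_length_def)

lemma curve_length_nonneg: "0 \<le> curve_length a b u1 u2"
  unfolding curve_length_def set_lebesgue_integral_def by (intro Bochner_Integration.integral_nonneg) simp

lemma cc_dist_le_curve_length:
  assumes "horizontal_with n a b \<gamma> u1 u2"
  shows "cc_dist n (\<gamma> a) (\<gamma> b) \<le> curve_length a b u1 u2"
  unfolding cc_dist_def
proof (rule cInf_lower)
  show "bdd_below {curve_length a b u1 u2 | a b u1 u2.
      \<exists>\<gamma>'. horizontal_with n a b \<gamma>' u1 u2 \<and> \<gamma>' a = x \<and> \<gamma>' b = y}" for x y
    by (rule bdd_belowI[of _ 0]) (use curve_length_nonneg in blast)
qed (use assms in blast)

lemma cc_dist_le:
  assumes h: "horizontal_with n a b \<gamma> u1 u2" and L: "\<And>t. t \<in> {a..b} \<Longrightarrow> norm (u1 t, u2 t) \<le> L"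
  shows "cc_dist n (\<gamma> a) (\<gamma> b) \<le> L * (b - a)"
proof -
  have ab: "a \<le> b" and int: "set_integrable lebesgue {a..b} u1" "set_integrable lebesgue {a..b} u2"
    using h by (auto simp: horizontal_with_def)
  have "curve_length a b u1 u2 \<le> integral {a..b} (\<lambda>t. L)"
    unfolding curve_length_integral(2)[OF int]
    by (intro integral_le curve_length_integral(1)[OF int]) (use L in auto)
  also have "\<dots> = L * (b - a)" using ab by simp
  finally show ?thesis using cc_dist_le_curve_length[OF h] by linarith
qed

text \<open>This turns a bound on the length into bounds on the coordinates: the increment is the integral of the
  derivative prescribed by the controls.\<close>

lemma horizontal_increment_le:
  assumes h: "horizontal_with n a b \<gamma> u1 u2" and i: "i \<in> {1..n}" and s: "s \<in> {a..b}" and c: "0 \<le> c"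
    and bd: "\<And>t. t \<in> {s..b} \<Longrightarrow> \<bar>u1 t * left_inv_field n (basis_vec 1) (\<gamma> t) i +
        u2 t * left_inv_field n (basis_vec 2) (\<gamma> t) i\<bar> \<le> c * norm (u1 t, u2 t)"
  shows "\<bar>\<gamma> b i - \<gamma> s i\<bar> \<le> c * curve_length a b u1 u2"
proof -
  let ?D = "\<lambda>t. u1 t * left_inv_field n (basis_vec 1) (\<gamma> t) i + u2 t * left_inv_field n (basis_vec 2) (\<gamma> t) i"
  note int = h[unfolded horizontal_with_def, THEN conjunct2, THEN conjunct2, THEN conjunct2]
  have u: "set_integrable lebesgue {a..b} u1" "set_integrable lebesgue {a..b} u2" using int by auto
  note len = curve_length_integral[OF u]
  have ac: "abs_continuous (\<lambda>t. \<gamma> t i) s b"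
  proof -
    have "abs_continuous (\<lambda>t. \<gamma> t i) a b" using h i by (auto simp: horizontal_with_def)
    then show ?thesis
      unfolding abs_continuous_def using s by (smt (verit) atLeastAtMost_iff)
  qed
  obtain N where N: "negligible N" and der: "\<And>t. t \<in> {a..b} - N \<Longrightarrow>
      ((\<lambda>s. \<gamma> s i) has_real_derivative ?D t) (at t within {a..b})"
  proof -
    have "AE t in lebesgue. t \<in> {a..b} \<longrightarrow> ((\<lambda>s. \<gamma> s i) has_real_derivative ?D t) (at t within {a..b})"
      using int i by (auto elim!: AE_mp)
    then show thesis
      using that by (auto simp: eventually_ae_filter negligible_iff_null_sets subset_iff)
  qed
  have D: "(?D has_integral \<gamma> b i - \<gamma> s i) {s..b}"
  proof (rule abs_continuous_has_integral[OF ac _ N])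
    fix t assume "t \<in> {s..b} - N"
    then show "((\<lambda>t. \<gamma> t i) has_real_derivative ?D t) (at t within {s..b})"
      using s by (intro DERIV_subset[OF der]) auto
  qed (use s in auto)
  have w: "(\<lambda>t. norm (u1 t, u2 t)) integrable_on {s..b}"
    using len(1) s by (auto intro: integrable_on_subinterval)
  have "norm (integral {s..b} ?D) \<le> integral {s..b} (\<lambda>t. c * norm (u1 t, u2 t))"
  proof (rule integral_norm_bound_integral)
    show "?D integrable_on {s..b}" using D by (rule has_integral_integrable)
    show "(\<lambda>t. c * norm (u1 t, u2 t)) integrable_on {s..b}" using w by (rule integrable_on_mult_right)
  qed (use bd in simp)
  then have "norm (\<gamma> b i - \<gamma> s i) \<le> integral {s..b} (\<lambda>t. c * norm (u1 t, u2 t))"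
    by (simp only: integral_unique[OF D])
  also have "\<dots> = c * integral {s..b} (\<lambda>t. norm (u1 t, u2 t))" by simp
  also have "\<dots> \<le> c * curve_length a b u1 u2"
    unfolding len(2) using s by (intro mult_left_mono integral_subset_le w len(1) c) auto
  finally show ?thesis by simp
qed

section \<open>Dimensions two and three\<close>

text \<open>In dimension two the third coordinate is discarded.  Every horizontal curve of \<open>E_3\<close> thus yields one of
  \<open>E_2\<close>, and both cases can be treated by the same formulas.\<close>

definition pt :: "nat \<Rightarrow> real \<Rightarrow> real \<Rightarrow> real \<Rightarrow> nat \<Rightarrow> real" where
  "pt n x y z = (\<lambda>i. if i = 1 then x else if i = 2 then y else if i = 3 \<and> n = 3 then z else 0)"

lemma pt_simps [simp]:
  "pt n x y z (Suc 0) = x" "pt n x y z 2 = y" "pt n x y z 3 = (if n = 3 then z else 0)"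
  by (auto simp: pt_def)

lemma pt_coords: "n = 2 \<or> n = 3 \<Longrightarrow> pt n x y z \<in> coords n"
  by (auto simp: pt_def coords_def)

lemma coords_eq_pt:
  assumes "n = 2 \<or> n = 3" "p \<in> coords n"
  shows "p = pt n (p 1) (p 2) (p 3)"
proof
  fix i
  have "i \<in> {1, 2, 3} \<or> i \<notin> {1..n}" using assms(1) by auto
  then show "p i = pt n (p 1) (p 2) (p 3) i"
    using assms by (auto simp: coords_def pt_def)
qed

lemma scale_pt: "scale c (pt n x y z) = pt n (c * x) (c * y) (c * z)"
  by (auto simp: scale_def pt_def)

lemma basis_vec_pt: "basis_vec 1 = pt n 1 0 0" "basis_vec 2 = pt n 0 1 0"
  by (auto simp: basis_vec_def pt_def)

lemma ad_series_pt:
  assumes "n = 2 \<or> n = 3"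
  shows "ad_series n c a (pt n x y z) = (\<lambda>i. if i = 2 then c 0 * y else if i = 3 \<and> n = 3 then c 0 * z - c 1 * a * y else 0)"
proof
  fix i :: nat
  have "i = 2 \<or> i = 3 \<or> i \<notin> {2..3}" by auto
  then show "ad_series n c a (pt n x y z) i = (if i = 2 then c 0 * y else if i = 3 \<and> n = 3 then c 0 * z - c 1 * a * y else 0)"
    using assms by (auto simp: ad_series_def pt_def)
qed

lemma sd_exp_pt:
  assumes "n = 2 \<or> n = 3"
  shows "sd_exp n (pt n x y z) = pt n x y (z - x * y / 2)"
  unfolding sd_exp_def ad_series_pt[OF assms] by (auto simp: fun_eq_iff pt_def)

lemma sd_mult_pt: "n = 2 \<or> n = 3 \<Longrightarrow>
    sd_mult n (pt n x y z) (pt n x' y' z') = pt n (x + x') (y + y') (z + z' - x * y')"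
  by (auto simp: sd_mult_def ad_series_pt fun_eq_iff) (auto simp: pt_def)

lemma mult_pt: "n = 2 \<or> n = 3 \<Longrightarrow>
    mult n (pt n x y z) (pt n x' y' z') = pt n (x + x') (y + y') (z + z' + (y * x' - x * y') / 2)"
  by (rule mult_eqI) (auto simp: sd_exp_pt sd_mult_pt pt_coords, auto simp: field_simps)

lemma left_inv_field_pt:
  assumes "n = 2 \<or> n = 3"
  shows "left_inv_field n (basis_vec 1) (pt n x y z) = pt n 1 0 (y / 2)"
    and "left_inv_field n (basis_vec 2) (pt n x y z) = pt n 0 1 (- x / 2)"
proof -
  have lin: "deriv (\<lambda>t. p + t * q) 0 = q" for p q :: real
    by (rule DERIV_imp_deriv) (auto intro!: derivative_eq_intros)
  show "left_inv_field n (basis_vec 1) (pt n x y z) = pt n 1 0 (y / 2)"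
    unfolding left_inv_field_def basis_vec_pt(1)[of n] scale_pt mult_pt[OF assms]
    using lin[of x 1] lin[of y 0] lin[of z "y / 2"] by (auto simp: pt_def algebra_simps fun_eq_iff)
  show "left_inv_field n (basis_vec 2) (pt n x y z) = pt n 0 1 (- x / 2)"
    unfolding left_inv_field_def basis_vec_pt(2)[of n] scale_pt mult_pt[OF assms]
    using lin[of x 0] lin[of y 1] lin[of z "- x / 2"] by (auto simp: pt_def algebra_simps fun_eq_iff)
qed

lemma horizontal_with_pt:
  fixes x y z u1 u2 :: "real \<Rightarrow> real"
  assumes n: "n = 2 \<or> n = 3" and ab: "a \<le> b" and S: "finite S"
    and cont: "continuous_on {a..b} x" "continuous_on {a..b} y" "continuous_on {a..b} z"
    and der: "\<And>t. t \<in> {a..b} - S \<Longrightarrow> (x has_real_derivative u1 t) (at t)"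
      "\<And>t. t \<in> {a..b} - S \<Longrightarrow> (y has_real_derivative u2 t) (at t)"
      "\<And>t. t \<in> {a..b} - S \<Longrightarrow> (z has_real_derivative (u1 t * y t - u2 t * x t) / 2) (at t)"
    and meas: "u1 \<in> borel_measurable borel" "u2 \<in> borel_measurable borel"
    and L: "\<And>t. t \<in> {a..b} \<Longrightarrow> norm (u1 t, u2 t) \<le> L"
  shows "horizontal_with n a b (\<lambda>t. pt n (x t) (y t) (z t)) u1 u2"
proof -
  have u: "\<bar>u1 t\<bar> \<le> L" "\<bar>u2 t\<bar> \<le> L" if "t \<in> {a..b}" for t
    using L[OF that] norm_fst_le[of "u1 t" "u2 t"] norm_snd_le[of "u2 t" "u1 t"] by auto
  have int: "set_integrable lebesgue {a..b} v"
    if "v \<in> borel_measurable borel" "\<And>t. t \<in> {a..b} \<Longrightarrow> \<bar>v t\<bar> \<le> L" for v :: "real \<Rightarrow> real"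
  proof (rule measurable_bounded_by_integrable_imp_absolutely_integrable)
    have "v \<in> borel_measurable lebesgue" using that(1) by (intro measurable_completion) simp
    then show "v \<in> borel_measurable (lebesgue_on {a..b})" by (rule measurable_restrict_space1)
  qed (use that(2) in auto)
  let ?D = "\<lambda>t. pt n (u1 t) (u2 t) ((u1 t * y t - u2 t * x t) / 2)"
  have i: "i = 1 \<or> i = 2 \<or> i = 3" if "i \<in> {1..n}" for i using that n by auto
  show ?thesis
  proof (rule horizontal_withI[OF ab _ _ _ S, where D = ?D])
    fix i assume "i \<in> {1..n}"
    have "bounded (x ` {a..b})" "bounded (y ` {a..b})"
      using cont by (auto intro!: compact_imp_bounded compact_continuous_image)
    then obtain X Y where XY: "\<And>t. t \<in> {a..b} \<Longrightarrow> \<bar>x t\<bar> \<le> X" "\<And>t. t \<in> {a..b} \<Longrightarrow> \<bar>y t\<bar> \<le> Y"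
      unfolding bounded_iff by (metis imageI real_norm_def)
    have z_bd: "\<bar>(u1 t * y t - u2 t * x t) / 2\<bar> \<le> L * Y + L * X" if "t \<in> {a..b}" for t
    proof -
      have "\<bar>u1 t * y t\<bar> \<le> L * Y" "\<bar>u2 t * x t\<bar> \<le> L * X"
        unfolding abs_mult using u[OF that] XY[OF that] by (auto intro!: mult_mono)
      then show ?thesis by (simp add: abs_le_iff)
    qed
    have "\<bar>?D t i\<bar> \<le> max L (L * Y + L * X)" if "t \<in> {a..b}" for t
    proof -
      have "0 \<le> L" using u(1)[OF that] by linarith
      then show ?thesis
        using i[OF \<open>i \<in> {1..n}\<close>] u[OF that] z_bd[OF that]
        by (elim disjE) (simp_all add: pt_def le_max_iff_disj)
    qed
    then show "\<exists>B. \<forall>t\<in>{a..b}. \<bar>?D t i\<bar> \<le> B" by blast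
    show "continuous_on {a..b} (\<lambda>t. pt n (x t) (y t) (z t) i)"
      using i[OF \<open>i \<in> {1..n}\<close>] cont by (cases "n = 3") (auto simp: pt_def)
  next
    fix t i assume t: "t \<in> {a..b} - S" and "i \<in> {1..n}"
    then show "((\<lambda>s. pt n (x s) (y s) (z s) i) has_real_derivative ?D t i) (at t)"
      using i[OF \<open>i \<in> {1..n}\<close>] der[OF t] by (cases "n = 3") (auto simp: pt_def)
    show "u1 t * left_inv_field n (basis_vec 1) (pt n (x t) (y t) (z t)) i +
        u2 t * left_inv_field n (basis_vec 2) (pt n (x t) (y t) (z t)) i = ?D t i"
      unfolding left_inv_field_pt[OF n] by (auto simp: pt_def algebra_simps diff_divide_distrib)
  qed (use pt_coords[OF n] int u meas in auto)
qed

text \<open>For \<open>s > t\<close> the curve has to be run backwards, since lengths are defined for curves on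
  \<open>{a..b}\<close> with \<open>a \<le> b\<close> only.\<close>

lemma cc_dist_pt_le:
  fixes x y z u1 u2 :: "real \<Rightarrow> real"
  assumes n: "n = 2 \<or> n = 3" and S: "finite S"
    and cont: "continuous_on UNIV x" "continuous_on UNIV y" "continuous_on UNIV z"
    and der: "\<And>t. t \<notin> S \<Longrightarrow> (x has_real_derivative u1 t) (at t)"
      "\<And>t. t \<notin> S \<Longrightarrow> (y has_real_derivative u2 t) (at t)"
      "\<And>t. t \<notin> S \<Longrightarrow> (z has_real_derivative (u1 t * y t - u2 t * x t) / 2) (at t)"
    and meas: "u1 \<in> borel_measurable borel" "u2 \<in> borel_measurable borel"
    and L: "\<And>t. norm (u1 t, u2 t) \<le> L"
  shows "cc_dist n (pt n (x s) (y s) (z s)) (pt n (x t) (y t) (z t)) \<le> L * \<bar>s - t\<bar>"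
proof (cases "s \<le> t")
  case True
  have "horizontal_with n s t (\<lambda>t. pt n (x t) (y t) (z t)) u1 u2"
    by (rule horizontal_with_pt[OF n True S]) (use der meas L cont in \<open>auto intro: continuous_on_subset\<close>)
  from cc_dist_le[OF this] L True show ?thesis by fastforce
next
  case False
  have mirror: "((\<lambda>r. f (- r)) has_real_derivative - d) (at r)"
    if "(f has_real_derivative d) (at (- r))" for f :: "real \<Rightarrow> real" and d r
  proof -
    have "(uminus has_real_derivative -1) (at r)" by (auto intro!: derivative_eq_intros)
    from DERIV_chain2[where f = f and g = uminus, OF that this] show ?thesis by simp
  qed
  have "horizontal_with n (- s) (- t) (\<lambda>r. pt n (x (- r)) (y (- r)) (z (- r)))
      (\<lambda>r. - u1 (- r)) (\<lambda>r. - u2 (- r))"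
  proof (rule horizontal_with_pt[OF n, of _ _ "uminus ` S" _ _ _ _ _ L])
    fix r assume "r \<in> {- s..- t} - uminus ` S"
    then have r: "- r \<notin> S" by force
    show "((\<lambda>r. x (- r)) has_real_derivative - u1 (- r)) (at r)"
      "((\<lambda>r. y (- r)) has_real_derivative - u2 (- r)) (at r)"
      "((\<lambda>r. z (- r)) has_real_derivative (- u1 (- r) * y (- r) - - u2 (- r) * x (- r)) / 2) (at r)"
      using mirror[OF der(1)[OF r]] mirror[OF der(2)[OF r]] mirror[OF der(3)[OF r]]
      by (simp_all add: diff_divide_distrib)
  next
    show "continuous_on {- s..- t} (\<lambda>r. x (- r))" "continuous_on {- s..- t} (\<lambda>r. y (- r))"
      "continuous_on {- s..- t} (\<lambda>r. z (- r))"
      using cont by (auto intro!: continuous_on_compose2[of UNIV _ _ uminus] continuous_intros)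
    show "norm (- u1 (- r), - u2 (- r)) \<le> L" for r
      using L[of "- r"] by (simp add: norm_Pair)
  qed (use False S meas in auto)
  from cc_dist_le[OF this, of L] L False show ?thesis by (fastforce simp: norm_Pair)
qed

text \<open>The infimum in the definition of the distance says something about curves only if there is a curve at all.
  Here the segment from \<open>(p, q)\<close> to the origin is bent to the planar curve
  \<open>(1 - t) (p + c t, q + k t\<^sup>2)\<close>.  The increment of the third coordinate along it is affine in
  \<open>k\<close>, and \<open>c\<close> is chosen such that the coefficient of \<open>k\<close> does not vanish.\<close>

lemma exists_horizontal_to_origin:
  assumes n: "n = 2 \<or> n = 3" and u: "u \<in> coords n"
  shows "\<exists>\<gamma> u1 u2. horizontal_with n 0 1 \<gamma> u1 u2 \<and> \<gamma> 0 = u \<and> \<gamma> 1 = origin"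
proof -
  define p q r where "p = u 1" and "q = u 2" and "r = u 3"
  \<comment> \<open>\<open>p / 6 + c / 30 = 1\<close>, so that \<open>z 0 = k / 2 - c q / 6\<close>\<close>
  define c where "c = 30 - 5 * p"
  define k where "k = c * q / 3 + 2 * r"
  define x where "x t = (1 - t) * (p + c * t)" for t
  define y where "y t = (1 - t) * (q + k * t\<^sup>2)" for t
  define z where "z t = - (c * q / 6 * (1 - t)^3 - k * p / 12 * (4 * (1 - t)^3 - 3 * (1 - t)^4)
      - c * k / 60 * (10 * (1 - t)^3 - 15 * (1 - t)^4 + 6 * (1 - t)^5))" for t
  define u1 where "u1 t = (1 - t) * c - (p + c * t)" for t
  define u2 where "u2 t = (1 - t) * (2 * k * t) - (q + k * t\<^sup>2)" for t
  have xy: "(x has_real_derivative u1 t) (at t)" "(y has_real_derivative u2 t) (at t)" for t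
    unfolding x_def y_def u1_def u2_def by (auto intro!: derivative_eq_intros)
  have z: "(z has_real_derivative (u1 t * y t - u2 t * x t) / 2) (at t)" for t
  proof -
    have "(z has_real_derivative c * q / 6 * (3 * (1 - t)^2)
        - k * p / 12 * (12 * (1 - t)^2 - 12 * (1 - t)^3)
        - c * k / 60 * (30 * (1 - t)^2 - 60 * (1 - t)^3 + 30 * (1 - t)^4)) (at t)"
      unfolding z_def by (rule derivative_eq_intros refl | simp)+ (simp add: field_simps)
    moreover have "c * q / 6 * (3 * (1 - t)^2) - k * p / 12 * (12 * (1 - t)^2 - 12 * (1 - t)^3)
        - c * k / 60 * (30 * (1 - t)^2 - 60 * (1 - t)^3 + 30 * (1 - t)^4) =
        (1 - t)^2 * (c * q - 2 * k * p * t - c * k * t^2) / 2"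
      by (simp add: field_simps) algebra
    moreover have "u1 t * y t - u2 t * x t = (1 - t)^2 * (c * q - 2 * k * p * t - c * k * t^2)"
      unfolding u1_def u2_def x_def y_def by algebra
    ultimately show ?thesis by (simp only:)
  qed
  have cont: "continuous_on {0..1} x" "continuous_on {0..1} y" "continuous_on {0..1} z"
    "continuous_on {0..1} (\<lambda>t. (u1 t, u2 t))"
    unfolding x_def y_def z_def u1_def u2_def by (auto intro!: continuous_intros)
  have meas: "u1 \<in> borel_measurable borel" "u2 \<in> borel_measurable borel"
    unfolding u1_def u2_def by measurable
  obtain L where L: "\<forall>t\<in>{0..1}. norm (u1 t, u2 t) \<le> L"
    using compact_imp_bounded[OF compact_continuous_image[OF cont(4) compact_Icc]]
    by (auto simp: bounded_iff)
  have "horizontal_with n 0 1 (\<lambda>t. pt n (x t) (y t) (z t)) u1 u2"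
    by (rule horizontal_with_pt[OF n _ finite.emptyI]) (use xy z cont meas L in auto)
  moreover have "z 0 = r" by (simp add: z_def k_def c_def field_simps)
  then have "pt n (x 0) (y 0) (z 0) = u"
    using coords_eq_pt[OF n u] by (simp add: x_def y_def p_def q_def r_def)
  moreover have "pt n (x 1) (y 1) (z 1) = origin"
    by (auto simp: x_def y_def z_def pt_def origin_def)
  ultimately show ?thesis by blast
qed

text \<open>A curve of length less than 2 joins \<open>u\<close> to the origin.  Its first two coordinates are at most 2, and
  then the third coordinates of the horizontal fields \<open>(1, 0, y / 2)\<close> and \<open>(0, 1, - x / 2)\<close> are
  at most 1 in absolute value, so that each control contributes at most the length to the third coordinate.\<close>

lemma cc_norm_le_1_imp:
  assumes n: "n = 2 \<or> n = 3" and u: "u \<in> coords n" and le: "cc_norm n u \<le> 1"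
  shows "\<bar>u 1\<bar> \<le> 2" "\<bar>u 2\<bar> \<le> 2" "\<bar>u 3\<bar> \<le> 4"
proof -
  let ?X = "{curve_length a b u1 u2 | a b u1 u2.
            \<exists>\<gamma>. horizontal_with n a b \<gamma> u1 u2 \<and> \<gamma> a = u \<and> \<gamma> b = origin}"
  have "?X \<noteq> {}" using exists_horizontal_to_origin[OF n u] by blast
  moreover have "Inf ?X < 2" using le by (simp add: cc_norm_def cc_dist_def)
  ultimately obtain a b u1 u2 \<gamma> where h: "horizontal_with n a b \<gamma> u1 u2" and ends: "\<gamma> a = u" "\<gamma> b = origin"
    and len: "curve_length a b u1 u2 < 2"
    using cInf_lessD[of ?X 2] by blast
  have ab: "a \<le> b" and co: "\<And>t. t \<in> {a..b} \<Longrightarrow> \<gamma> t \<in> coords n"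
    using h by (auto simp: horizontal_with_def)
  have field: "left_inv_field n (basis_vec 1) (\<gamma> t) = pt n 1 0 (\<gamma> t 2 / 2)"
    "left_inv_field n (basis_vec 2) (\<gamma> t) = pt n 0 1 (- \<gamma> t 1 / 2)" if "t \<in> {a..b}" for t
    using left_inv_field_pt[OF n, of "\<gamma> t 1" "\<gamma> t 2" "\<gamma> t 3"] coords_eq_pt[OF n co[OF that]] by simp_all
  have w: "\<bar>u1 t\<bar> \<le> norm (u1 t, u2 t)" "\<bar>u2 t\<bar> \<le> norm (u1 t, u2 t)" for t
    using norm_fst_le[of "u1 t" "u2 t"] norm_snd_le[of "u2 t" "u1 t"] by auto
  have 1: "\<bar>\<gamma> s 1\<bar> \<le> 2" and 2: "\<bar>\<gamma> s 2\<bar> \<le> 2" if s: "s \<in> {a..b}" for s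
  proof -
    have "\<bar>\<gamma> b 1 - \<gamma> s 1\<bar> \<le> 1 * curve_length a b u1 u2"
      by (rule horizontal_increment_le[OF h]) (use n s field w in auto)
    then show "\<bar>\<gamma> s 1\<bar> \<le> 2" using len ends by (simp add: origin_def)
    have "\<bar>\<gamma> b 2 - \<gamma> s 2\<bar> \<le> 1 * curve_length a b u1 u2"
      by (rule horizontal_increment_le[OF h]) (use n s field w in auto)
    then show "\<bar>\<gamma> s 2\<bar> \<le> 2" using len ends by (simp add: origin_def)
  qed
  show "\<bar>u 1\<bar> \<le> 2" "\<bar>u 2\<bar> \<le> 2" using 1[of a] 2[of a] ab ends by auto
  show "\<bar>u 3\<bar> \<le> 4"
  proof (cases "n = 3")
    case True
    have "\<bar>\<gamma> b 3 - \<gamma> a 3\<bar> \<le> 2 * curve_length a b u1 u2"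
    proof (rule horizontal_increment_le[OF h])
      fix t assume t: "t \<in> {a..b}"
      have "\<bar>u1 t * \<gamma> t 2\<bar> \<le> norm (u1 t, u2 t) * 2" "\<bar>u2 t * \<gamma> t 1\<bar> \<le> norm (u1 t, u2 t) * 2"
        unfolding abs_mult by (intro mult_mono; use w 1[OF t] 2[OF t] in simp)+
      then show "\<bar>u1 t * left_inv_field n (basis_vec 1) (\<gamma> t) 3 +
          u2 t * left_inv_field n (basis_vec 2) (\<gamma> t) 3\<bar> \<le> 2 * norm (u1 t, u2 t)"
        unfolding field[OF t] using True by simp
    qed (use True ab in auto)
    then show ?thesis using len ends by (simp add: origin_def)
  next
    case False
    then show ?thesis using n u by (auto simp: coords_def)
  qed
qed

section \<open>Lifts of broken lines\<close>

text \<open>A broken line with knots \<open>\<tau> 0 \<le> \<dots> \<le> \<tau> (K - 1)\<close>, vanishing to the left of all knots and having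
  slope \<open>s k\<close> between \<open>\<tau> (k - 1)\<close> and \<open>\<tau> k\<close>, is a combination of the hinges
  \<open>max 0 (t - \<tau> j)\<close> whose coefficients are the jumps of the slope.  In this form derivative and
  antiderivative (\<open>area\<close>) are sums of the same shape, and continuity is evident.\<close>

definition slope :: "nat \<Rightarrow> (nat \<Rightarrow> real) \<Rightarrow> (nat \<Rightarrow> real) \<Rightarrow> real \<Rightarrow> real" where
  "slope K \<tau> s t = (\<Sum>j<K. (s (Suc j) - s j) * (if \<tau> j < t then 1 else 0))"

definition broken_line :: "nat \<Rightarrow> (nat \<Rightarrow> real) \<Rightarrow> (nat \<Rightarrow> real) \<Rightarrow> real \<Rightarrow> real" where
  "broken_line K \<tau> s t = (\<Sum>j<K. (s (Suc j) - s j) * max 0 (t - \<tau> j))"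

definition area :: "nat \<Rightarrow> (nat \<Rightarrow> real) \<Rightarrow> (nat \<Rightarrow> real) \<Rightarrow> real \<Rightarrow> real" where
  "area K \<tau> s t = (\<Sum>j<K. (s (Suc j) - s j) * ((max 0 (t - \<tau> j))\<^sup>2 / 2))"

text \<open>The horizontal curve with controls \<open>(slope, \<sigma>)\<close>.  In semidirect product coordinates its third
  coordinate is \<open>- \<sigma> area\<close>; the other summand comes from passing to exponential coordinates.\<close>

definition lift :: "nat \<Rightarrow> real \<Rightarrow> nat \<Rightarrow> (nat \<Rightarrow> real) \<Rightarrow> (nat \<Rightarrow> real) \<Rightarrow> real \<Rightarrow> nat \<Rightarrow> real" where
  "lift n \<sigma> K \<tau> s t = pt n (broken_line K \<tau> s t) (\<sigma> * t)
     (\<sigma> * (t * broken_line K \<tau> s t / 2 - area K \<tau> s t))"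

lemma hinge_deriv:
  assumes "t \<noteq> c"
  shows "((\<lambda>t. max 0 (t - c)) has_real_derivative (if c < t then 1 else 0)) (at t)"
proof (cases "c < t")
  case True
  have "((\<lambda>t. t - c) has_real_derivative 1) (at t)" by (auto intro!: derivative_eq_intros)
  moreover have "\<forall>\<^sub>F r in nhds t. max 0 (r - c) = r - c"
    using eventually_nhds_in_open[of "{c<..}" t] True by (auto elim!: eventually_mono)
  ultimately show ?thesis using True by (subst DERIV_cong_ev) auto
next
  case False
  have "((\<lambda>t. 0) has_real_derivative 0) (at t)" by simp
  moreover have "\<forall>\<^sub>F r in nhds t. max 0 (r - c) = 0"
    using eventually_nhds_in_open[of "{..<c}" t] False assms by (auto elim!: eventually_mono)
  ultimately show ?thesis using False by (subst DERIV_cong_ev) auto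
qed

lemma broken_line_deriv:
  assumes "t \<notin> \<tau> ` {..<K}"
  shows "(broken_line K \<tau> s has_real_derivative slope K \<tau> s t) (at t)"
  unfolding broken_line_def slope_def
  by (intro DERIV_sum DERIV_cmult hinge_deriv) (use assms in auto)

lemma area_deriv:
  assumes "t \<notin> \<tau> ` {..<K}"
  shows "(area K \<tau> s has_real_derivative broken_line K \<tau> s t) (at t)"
  unfolding broken_line_def area_def
proof (intro DERIV_sum DERIV_cmult)
  fix j assume "j \<in> {..<K}"
  with assms have "t \<noteq> \<tau> j" by auto
  from DERIV_cdivide[OF DERIV_power[OF hinge_deriv[OF this], of 2], of 2]
  show "((\<lambda>t. (max 0 (t - \<tau> j))\<^sup>2 / 2) has_real_derivative max 0 (t - \<tau> j)) (at t)"
    by (rule DERIV_cong) auto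
qed

lemma sum_jumps:
  fixes s F G :: "nat \<Rightarrow> real"
  assumes k: "k \<le> K"
    and before: "\<And>j. j < k \<Longrightarrow> F j = G j" and after: "\<And>j. k \<le> j \<Longrightarrow> j < K \<Longrightarrow> F j = 0"
  shows "(\<Sum>j<K. (s (Suc j) - s j) * F j) = (\<Sum>j<k. (s (Suc j) - s j) * G j)"
proof (rule sum.mono_neutral_cong_right)
  show "\<forall>j\<in>{..<K} - {..<k}. (s (Suc j) - s j) * F j = 0"
    using after by simp
qed (use k before in auto)

lemma knot_index:
  fixes \<tau> :: "nat \<Rightarrow> real"
  assumes mono: "mono_on {..<K} \<tau>"
  obtains k where "k \<le> K" "\<And>j. j < k \<Longrightarrow> \<tau> j < t" "\<And>j. k \<le> j \<Longrightarrow> j < K \<Longrightarrow> t \<le> \<tau> j"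
proof (cases "\<exists>j<K. t \<le> \<tau> j")
  case True
  define k where "k = (LEAST j. j < K \<and> t \<le> \<tau> j)"
  have k: "k < K" "t \<le> \<tau> k"
    using LeastI_ex[of "\<lambda>j. j < K \<and> t \<le> \<tau> j"] True by (auto simp: k_def)
  show thesis
  proof (rule that[of k])
    show "\<tau> j < t" if "j < k" for j
      using not_less_Least[of j "\<lambda>j. j < K \<and> t \<le> \<tau> j"] that k by (auto simp: k_def)
    show "t \<le> \<tau> j" if "k \<le> j" "j < K" for j
      using mono_onD[OF mono, of k j] that k by auto
  qed (use k in simp)
next
  case False
  then show thesis by (intro that[of K]) force+
qed

lemma slope_eq:
  assumes s0: "s 0 = 0" and mono: "mono_on {..<K} \<tau>"
  shows "\<exists>k\<le>K. slope K \<tau> s t = s k"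
proof -
  obtain k where k: "k \<le> K" "\<And>j. j < k \<Longrightarrow> \<tau> j < t" "\<And>j. k \<le> j \<Longrightarrow> j < K \<Longrightarrow> t \<le> \<tau> j"
    using knot_index[OF mono, of t] by blast
  have "slope K \<tau> s t = (\<Sum>j<k. (s (Suc j) - s j) * 1)"
    unfolding slope_def by (rule sum_jumps[OF k(1)]) (use k(2,3) in \<open>auto simp: not_less\<close>)
  also have "\<dots> = s k" by (simp add: sum_lessThan_telescope s0)
  finally show ?thesis using k(1) by blast
qed

text \<open>Between two knots the broken line is affine and its area quadratic, so the lift is the translate of a
  one-parameter subgroup; \<open>b\<close> and \<open>- \<sigma> d\<close> are the coordinates of the line at time 0.\<close>

lemma joins_lines_lift:
  assumes n: "n = 2 \<or> n = 3" and s0: "s 0 = 0"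
    and mono: "mono_on {..<K} \<tau>"
  shows "joins_lines n (Suc K) (lift n \<sigma> K \<tau> s)"
proof -
  define I where "I k = {t. (\<forall>j<k. \<tau> j \<le> t) \<and> (\<forall>j. k \<le> j \<and> j < K \<longrightarrow> t \<le> \<tau> j)}" for k
  have interval: "is_interval (I k)" for k
    unfolding is_interval_1 I_def by (auto intro: order_trans)
  have cover: "\<exists>k\<le>K. t \<in> I k" for t
  proof -
    obtain k where k: "k \<le> K" "\<And>j. j < k \<Longrightarrow> \<tau> j < t" "\<And>j. k \<le> j \<Longrightarrow> j < K \<Longrightarrow> t \<le> \<tau> j"
      using knot_index[OF mono, of t] by blast
    then have "t \<in> I k" unfolding I_def using less_imp_le by blast
    then show ?thesis using k(1) by blast
  qed
  have order: "r \<le> t" if "j < k" "k < Suc K" "r \<in> I j" "t \<in> I k" for j k r t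
  proof -
    have "r \<le> \<tau> j" "\<tau> j \<le> t" using that by (auto simp: I_def)
    then show ?thesis by simp
  qed
  have line: "\<exists>L. horizontal_line n L \<and> (\<forall>t\<in>I k. lift n \<sigma> K \<tau> s t = L t)" if "k < Suc K" for k
  proof -
    define b where "b = (\<Sum>j<k. (s (Suc j) - s j) * (- \<tau> j))"
    define d where "d = (\<Sum>j<k. (s (Suc j) - s j) * ((\<tau> j)\<^sup>2 / 2))"
    have tele: "(\<Sum>j<k. (s (Suc j) - s j)) = s k" by (simp add: sum_lessThan_telescope s0)
    have bl: "broken_line K \<tau> s t = s k * t + b" and ar: "area K \<tau> s t = s k * t\<^sup>2 / 2 + b * t + d"
      if "t \<in> I k" for t
    proof -
      have "broken_line K \<tau> s t = (\<Sum>j<k. (s (Suc j) - s j) * (t - \<tau> j))"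
        unfolding broken_line_def by (rule sum_jumps) (use \<open>k < Suc K\<close> that in \<open>auto simp: I_def max_def\<close>)
      also have "\<dots> = s k * t + b"
        unfolding b_def tele[symmetric] sum_distrib_right sum.distrib[symmetric]
        by (intro sum.cong) (auto simp: algebra_simps)
      finally show "broken_line K \<tau> s t = s k * t + b" .
      have "area K \<tau> s t = (\<Sum>j<k. (s (Suc j) - s j) * ((t - \<tau> j)\<^sup>2 / 2))"
        unfolding area_def by (rule sum_jumps) (use \<open>k < Suc K\<close> that in \<open>auto simp: I_def max_def\<close>)
      also have "\<dots> = s k * (t\<^sup>2 / 2) + b * t + d"
        unfolding b_def d_def tele[symmetric] sum_distrib_right sum.distrib[symmetric]
        by (intro sum.cong) (auto simp: algebra_simps power2_eq_square add_divide_distrib diff_divide_distrib)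
      finally show "area K \<tau> s t = s k * t\<^sup>2 / 2 + b * t + d" by simp
    qed
    define L where "L = (\<lambda>t. mult n (pt n b 0 (- \<sigma> * d)) (scale t (pt n (s k) \<sigma> 0)))"
    have "pt n (s k) \<sigma> 0 \<in> horizontal_layer n"
      unfolding horizontal_layer_def mem_Collect_eq
      by (intro exI[of _ "s k"] exI[of _ \<sigma>]) (auto simp: pt_def basis_vec_def)
    then have "horizontal_line n L"
      unfolding horizontal_line_def L_def using pt_coords[OF n] by blast
    moreover have "lift n \<sigma> K \<tau> s t = L t" if "t \<in> I k" for t
      unfolding lift_def L_def scale_pt mult_pt[OF n] bl[OF that] ar[OF that]
      by (rule arg_cong3[where f = "pt n"]) (simp_all add: field_simps power2_eq_square)
    ultimately show ?thesis by blast
  qed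
  have union: "(\<Union>k<Suc K. I k) = UNIV"
    using cover by (metis UNIV_eq_I UN_I lessThan_iff less_Suc_eq_le)
  show ?thesis
    unfolding joins_lines_def
    by (intro exI[of _ "Suc K"] exI[of _ I] conjI allI impI)
       (use interval union order line in \<open>auto simp: less_Suc_eq_le\<close>)
qed

lemma lift_cont:
  "continuous_on A (broken_line K \<tau> s)" "continuous_on A (area K \<tau> s)"
  unfolding broken_line_def area_def by (auto intro!: continuous_intros)

context
  fixes n K :: nat and \<sigma> M :: real and \<tau> s :: "nat \<Rightarrow> real"
  assumes n: "n = 2 \<or> n = 3" and \<sigma>: "\<sigma> = 1 \<or> \<sigma> = -1" and s0: "s 0 = 0"
    and mono: "mono_on {..<K} \<tau>"
    and M: "\<And>k. k \<le> K \<Longrightarrow> \<bar>s k\<bar> \<le> M"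
begin

lemma abs_slope_le: "\<bar>slope K \<tau> s t\<bar> \<le> M"
  using slope_eq[of s K \<tau> t, OF s0 mono] M by auto

lemma lift_facts:
  "finite (\<tau> ` {..<K})"
  "continuous_on A (broken_line K \<tau> s)"
  "continuous_on A (\<lambda>t. \<sigma> * t)"
  "continuous_on A (\<lambda>t. \<sigma> * (t * broken_line K \<tau> s t / 2 - area K \<tau> s t))"
  "\<And>t. t \<notin> \<tau> ` {..<K} \<Longrightarrow> (broken_line K \<tau> s has_real_derivative slope K \<tau> s t) (at t)"
  "\<And>t. ((\<lambda>t. \<sigma> * t) has_real_derivative \<sigma>) (at t)"
  "\<And>t. t \<notin> \<tau> ` {..<K} \<Longrightarrow>
    ((\<lambda>t. \<sigma> * (t * broken_line K \<tau> s t / 2 - area K \<tau> s t)) has_real_derivative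
     (slope K \<tau> s t * (\<sigma> * t) - \<sigma> * broken_line K \<tau> s t) / 2) (at t)"
  "slope K \<tau> s \<in> borel_measurable borel" "(\<lambda>t. \<sigma>) \<in> borel_measurable borel"
  "\<And>t. norm (slope K \<tau> s t, \<sigma>) \<le> sqrt (1 + M\<^sup>2)"
proof -
  show "((\<lambda>t. \<sigma> * (t * broken_line K \<tau> s t / 2 - area K \<tau> s t)) has_real_derivative
     (slope K \<tau> s t * (\<sigma> * t) - \<sigma> * broken_line K \<tau> s t) / 2) (at t)" if "t \<notin> \<tau> ` {..<K}" for t
    using broken_line_deriv[OF that, of s] area_deriv[OF that, of s]
    by (auto intro!: derivative_eq_intros simp: field_simps)
  show "slope K \<tau> s \<in> borel_measurable borel"
    unfolding slope_def by measurable
  show "norm (slope K \<tau> s t, \<sigma>) \<le> sqrt (1 + M\<^sup>2)" for t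
    using abs_slope_le[of t] \<sigma> power_mono[of "\<bar>slope K \<tau> s t\<bar>" M 2] by (auto simp: norm_Pair)
qed (auto intro!: continuous_intros lift_cont broken_line_deriv derivative_eq_intros)

lemma lift_horizontal: "horizontal_curve n (lift n \<sigma> K \<tau> s)"
  unfolding horizontal_curve_def
proof (intro allI impI)
  fix a b :: real assume "a \<le> b"
  have "horizontal_with n a b (lift n \<sigma> K \<tau> s) (slope K \<tau> s) (\<lambda>t. \<sigma>)"
    unfolding lift_def[abs_def]
    by (rule horizontal_with_pt[OF n \<open>a \<le> b\<close> lift_facts(1,2,3,4) _ _ _ lift_facts(8,9,10)])
       (use lift_facts in auto)
  then show "\<exists>u1 u2. horizontal_with n a b (lift n \<sigma> K \<tau> s) u1 u2" by blast
qed

lemma lift_lip: "sqrt (1 + M\<^sup>2) \<in> lip_bounds n (lift n \<sigma> K \<tau> s)"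
  unfolding lip_bounds_def
proof (intro CollectI conjI allI)
  show "cc_dist n (lift n \<sigma> K \<tau> s r) (lift n \<sigma> K \<tau> s t) \<le> sqrt (1 + M\<^sup>2) * \<bar>r - t\<bar>" for r t
    unfolding lift_def[abs_def]
    by (rule cc_dist_pt_le[OF n lift_facts(1,2,3,4) _ _ _ lift_facts(8,9,10)])
       (use lift_facts in auto)
qed simp

lemma lift_cc_Lip: "cc_lipschitz n (lift n \<sigma> K \<tau> s)" "cc_Lip n (lift n \<sigma> K \<tau> s) \<le> sqrt (1 + M\<^sup>2)"
proof -
  show "cc_lipschitz n (lift n \<sigma> K \<tau> s)" unfolding cc_lipschitz_def using lift_lip by blast
  show "cc_Lip n (lift n \<sigma> K \<tau> s) \<le> sqrt (1 + M\<^sup>2)"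
    unfolding cc_Lip_def by (rule cInf_lower[OF lift_lip]) (auto simp: lip_bounds_def intro: bdd_belowI[of _ 0])
qed

lemma lift_direction:
  "finite {t. \<not> (\<exists>w. ((\<lambda>r. proj (lift n \<sigma> K \<tau> s r)) has_vector_derivative w) (at t) \<and>
                     norm (w - (0, \<sigma>)) \<le> M)}"
proof (rule finite_subset[OF _ lift_facts(1)], rule subsetI, rule ccontr)
  fix t
  assume t: "t \<in> {t. \<not> (\<exists>w. ((\<lambda>r. proj (lift n \<sigma> K \<tau> s r)) has_vector_derivative w) (at t) \<and>
                     norm (w - (0, \<sigma>)) \<le> M)}" and "t \<notin> \<tau> ` {..<K}"
  then have "((\<lambda>r. (broken_line K \<tau> s r, \<sigma> * r)) has_vector_derivative (slope K \<tau> s t, \<sigma>)) (at t)"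
    using lift_facts(5,6)
    by (intro has_vector_derivative_Pair) (auto simp: has_real_derivative_iff_has_vector_derivative)
  moreover have "norm ((slope K \<tau> s t, \<sigma>) - (0, \<sigma>)) \<le> M" using abs_slope_le by (simp add: norm_Pair)
  moreover have "(\<lambda>r. proj (lift n \<sigma> K \<tau> s r)) = (\<lambda>r. (broken_line K \<tau> s r, \<sigma> * r))"
    by (simp add: proj_def lift_def)
  ultimately show False using t unfolding mem_Collect_eq by metis
qed

end

section \<open>Deformation of vertical lines\<close>

text \<open>Use the knots \<open>- l, z - h, z, z + k, l\<close>, the inner ones being the midpoints of \<open>[- l, z]\<close> and
  \<open>[z, l]\<close>.  The two slopes on the left are determined by value \<open>\<alpha>\<close> and area \<open>\<mu>\<close> at
  \<open>z\<close>; those on the right arise in the same way from the reversed curve, which must lose the area \<open>\<mu>\<close> again.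
  Since \<open>h, k \<ge> l / 4\<close>, all slopes are of order \<open>\<bar>\<alpha>\<bar> / l + \<bar>\<mu>\<bar> / l\<^sup>2\<close>.\<close>

lemma deformation_slopes_exist:
  fixes \<alpha> \<mu> :: real
  assumes l: "0 < l" and z: "\<bar>z\<bar> \<le> l / 2"
    and \<alpha>: "\<bar>\<alpha>\<bar> \<le> 2 * \<Delta> * l" and \<mu>: "\<bar>\<mu>\<bar> \<le> 3 / 2 * \<Delta> * l\<^sup>2"
  obtains \<tau> s where "s 0 = 0" "mono_on {..<5} \<tau>" "\<And>k. k \<le> 5 \<Longrightarrow> \<bar>s k\<bar> \<le> 36 * \<Delta>"
    and "broken_line 5 \<tau> s z = \<alpha>" "area 5 \<tau> s z = \<mu>"
    and "\<And>t. l \<le> \<bar>t\<bar> \<Longrightarrow> broken_line 5 \<tau> s t = 0 \<and> area 5 \<tau> s t = 0"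
proof -
  define h k where "h = (l + z) / 2" and "k = (l - z) / 2"
  have hk: "l / 4 \<le> h" "l / 4 \<le> k" "0 < h" "0 < k" using z l by (auto simp: h_def k_def)
  define s1 s2 s3 s4 where "s1 = \<mu> / h\<^sup>2 - \<alpha> / (2 * h)" and "s2 = 3 * \<alpha> / (2 * h) - \<mu> / h\<^sup>2"
    and "s3 = - 3 * \<alpha> / (2 * k) - \<mu> / k\<^sup>2" and "s4 = \<mu> / k\<^sup>2 + \<alpha> / (2 * k)"
  define \<tau> where "\<tau> j = [- l, z - h, z, z + k, l] ! j" for j
  define s where "s j = [0, s1, s2, s3, s4, 0] ! j" for j
  have eqs: "h * (s1 + s2) = \<alpha>" "h\<^sup>2 * (3 * s1 + s2) = 2 * \<mu>"
    "k * (s3 + s4) = - \<alpha>" "k\<^sup>2 * (3 * s4 + s3) = 2 * \<mu>"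
    using hk by (simp_all add: s1_def s2_def s3_def s4_def field_simps power2_eq_square)
  have zl: "l = 2 * h - z" "l = 2 * k + z" by (simp_all add: h_def k_def field_simps)
  have sum5: "(\<Sum>j<5. F j) = F 0 + F 1 + F 2 + F 3 + F 4" for F :: "nat \<Rightarrow> real"
    by (simp add: eval_nat_numeral)
  have knots: "\<tau> 0 = - l" "\<tau> 1 = z - h" "\<tau> 2 = z" "\<tau> 3 = z + k" "\<tau> 4 = l"
    and slopes: "s (Suc 0) = s1" "s (Suc 1) = s2" "s (Suc 2) = s3" "s (Suc 3) = s4" "s (Suc 4) = 0"
      "s 0 = 0" "s 1 = s1" "s 2 = s2" "s 3 = s3" "s 4 = s4"
    by (simp_all add: \<tau>_def s_def)
  have ordered: "- l \<le> z - h" "z - h \<le> z" "z \<le> z + k" "z + k \<le> l" using hk zl by linarith+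
  note unfold5 = broken_line_def area_def sum5 knots slopes
  show thesis
  proof
    show "s 0 = 0" by (simp add: s_def)
    show "mono_on {..<5} \<tau>"
    proof (rule mono_onI)
      fix i j :: nat assume "i \<in> {..<5}" "j \<in> {..<5}" "i \<le> j"
      then have "j \<in> {0, 1, 2, 3, 4}" "i \<in> {0, 1, 2, 3, 4}" by auto
      then show "\<tau> i \<le> \<tau> j" using \<open>i \<le> j\<close> ordered by (auto simp: \<tau>_def)
    qed
    have small: "\<bar>\<mu> / m\<^sup>2\<bar> \<le> 24 * \<Delta>" "\<bar>\<alpha> / (2 * m)\<bar> \<le> 4 * \<Delta>" if m: "l / 4 \<le> m" for m
    proof -
      have "m > 0" using m l by linarith
      have \<Delta>: "\<Delta> \<ge> 0" using order_trans[OF abs_ge_zero \<alpha>] l by (simp add: zero_le_mult_iff)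
      have "l\<^sup>2 \<le> 16 * m\<^sup>2" using power_mono[OF m, of 2] l by (simp add: field_simps power2_eq_square)
      then have "3 / 2 * \<Delta> * l\<^sup>2 \<le> 3 / 2 * \<Delta> * (16 * m\<^sup>2)" using \<Delta> by (intro mult_left_mono) auto
      then show "\<bar>\<mu> / m\<^sup>2\<bar> \<le> 24 * \<Delta>" using \<mu> \<open>m > 0\<close> by (simp add: pos_divide_le_eq)
      have "2 * \<Delta> * l \<le> 2 * \<Delta> * (4 * m)" using \<Delta> m by (intro mult_left_mono) auto
      then show "\<bar>\<alpha> / (2 * m)\<bar> \<le> 4 * \<Delta>" using \<alpha> \<open>m > 0\<close> by (simp add: abs_mult pos_divide_le_eq)
    qed
    show "\<bar>s k\<bar> \<le> 36 * \<Delta>" if "k \<le> 5" for k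
    proof -
      have "k \<in> {0, 1, 2, 3, 4, 5}" using that by auto
      moreover have "\<bar>s1\<bar> \<le> 36 * \<Delta>" "\<bar>s2\<bar> \<le> 36 * \<Delta>" "\<bar>s3\<bar> \<le> 36 * \<Delta>" "\<bar>s4\<bar> \<le> 36 * \<Delta>" "0 \<le> 36 * \<Delta>"
      proof -
        have "3 * \<alpha> / (2 * m) = 3 * (\<alpha> / (2 * m))" "- 3 * \<alpha> / (2 * m) = - 3 * (\<alpha> / (2 * m))" for m by auto
        then show "\<bar>s1\<bar> \<le> 36 * \<Delta>" "\<bar>s2\<bar> \<le> 36 * \<Delta>" "\<bar>s3\<bar> \<le> 36 * \<Delta>" "\<bar>s4\<bar> \<le> 36 * \<Delta>" "0 \<le> 36 * \<Delta>"
          unfolding s1_def s2_def s3_def s4_def using small[OF hk(1)] small[OF hk(2)] by linarith+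
      qed
      ultimately show ?thesis by (auto simp: s_def)
    qed
    have at_z: "max 0 (z - - l) = 2 * h" "max 0 (z - (z - h)) = h" "max 0 (z - z) = 0"
      "max 0 (z - (z + k)) = 0" "max 0 (z - l) = 0"
      using hk zl by linarith+
    have "broken_line 5 \<tau> s z = h * (s1 + s2)"
      unfolding unfold5 at_z by (simp add: algebra_simps)
    then show "broken_line 5 \<tau> s z = \<alpha>" using eqs(1) by simp
    have "area 5 \<tau> s z = h\<^sup>2 * (3 * s1 + s2) / 2"
      unfolding unfold5 at_z by (simp add: field_simps power2_eq_square)
    then show "area 5 \<tau> s z = \<mu>" using eqs(2) by simp
    show "broken_line 5 \<tau> s t = 0 \<and> area 5 \<tau> s t = 0" if "l \<le> \<bar>t\<bar>" for t
    proof (cases "t \<ge> 0")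
      case True
      then have "l \<le> t" using that by simp
      then have past: "max 0 (t - - l) = (t - z) + 2 * h" "max 0 (t - (z - h)) = (t - z) + h"
        "max 0 (t - z) = t - z" "max 0 (t - (z + k)) = (t - z) - k" "max 0 (t - l) = (t - z) - 2 * k"
        using hk zl by linarith+
      have "broken_line 5 \<tau> s t = h * (s1 + s2) + k * (s3 + s4)"
        unfolding unfold5 past by (simp add: algebra_simps)
      moreover have "area 5 \<tau> s t = (2 * (t - z) * (h * (s1 + s2) + k * (s3 + s4))
          + h\<^sup>2 * (3 * s1 + s2) - k\<^sup>2 * (3 * s4 + s3)) / 2"
        unfolding unfold5 past by (simp add: field_simps power2_eq_square)
      ultimately show ?thesis using eqs by simp
    next
      case False
      then have "t \<le> - l" using that by simp
      then have "max 0 (t - - l) = 0" "max 0 (t - (z - h)) = 0"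
        "max 0 (t - z) = 0" "max 0 (t - (z + k)) = 0" "max 0 (t - l) = 0"
        using hk zl by linarith+
      then show ?thesis unfolding unfold5 by simp
    qed
  qed
qed

text \<open>The left-hand side is the time \<open>\<zeta>\<close> at which the deformed curve has to pass through \<open>x\<close>.\<close>

lemma inner_vertical:
  assumes "n \<ge> 2"
  shows "inner_n n x (left_inv_field n (scale \<sigma> (basis_vec 2)) origin) = \<sigma> * x 2"
proof -
  have "scale \<sigma> (basis_vec 2) \<in> coords n" using assms by (auto simp: coords_def scale_def basis_vec_def)
  then have field: "left_inv_field n (scale \<sigma> (basis_vec 2)) origin = scale \<sigma> (basis_vec 2)"
    using assms by (intro left_inv_field_origin) auto
  have "inner_n n x (left_inv_field n (scale \<sigma> (basis_vec 2)) origin) = (\<Sum>i\<in>{1..n}. if i = 2 then \<sigma> * x 2 else 0)"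
    unfolding field inner_n_def by (rule sum.cong) (auto simp: scale_def basis_vec_def)
  then show ?thesis using assms by simp
qed

lemma vertical_direction:
  assumes "\<sigma> = 1 \<or> \<sigma> = -1"
  shows "scale \<sigma> (basis_vec 2) \<in> horizontal_layer n" "omega (scale \<sigma> (basis_vec 2)) = 1"
proof -
  show "scale \<sigma> (basis_vec 2) \<in> horizontal_layer n"
    unfolding horizontal_layer_def mem_Collect_eq
    by (intro exI[of _ 0] exI[of _ \<sigma>]) (simp add: scale_def)
  show "omega (scale \<sigma> (basis_vec 2)) = 1"
    using assms by (auto simp: omega_def proj_def scale_def basis_vec_def norm_Pair)
qed

text \<open>With \<open>r = \<Delta> l\<close> the target \<open>\<delta>_r(u)\<close> has first coordinate \<open>\<alpha> = r u_1\<close> and is to be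
  reached at \<open>z = \<sigma> r u_2\<close>, where the second coordinate \<open>\<sigma> t\<close> of the lift is already correct.
  Comparing third coordinates gives \<open>\<mu>\<close>, which is quadratic in \<open>r\<close>, so the
  slopes are of order \<open>\<Delta>\<close>.\<close>

lemma vertical_deformable:
  assumes n: "n = 2 \<or> n = 3" and \<sigma>: "\<sigma> = 1 \<or> \<sigma> = -1"
  shows "deformable n (scale \<sigma> (basis_vec 2))"
  unfolding deformable_def
  \<comment> \<open>\<open>\<Delta> < 1 / 4\<close> gives \<open>\<bar>z\<bar> \<le> l / 2\<close>, and \<open>648 = 36\<^sup>2 / 2\<close> gives \<open>(36 \<Delta>)\<^sup>2 \<le> 2 \<eta> \<Delta>\<close>\<close>
proof (intro conjI vertical_direction[OF \<sigma>] exI[of _ "36::real"] exI[of _ "6::nat"]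
    exI[of _ "\<lambda>\<eta>. min (1 / 4) (\<eta> / 648)"] allI impI; (elim conjE)?)
  fix l \<eta> \<Delta> :: real and u
  assume l: "0 < l" "l < 1" and "0 < \<eta>" "0 < \<Delta>" and \<Delta>: "\<Delta> < min (1 / 4) (\<eta> / 648)"
    and u: "u \<in> coords n" "cc_norm n u \<le> 1"
  let ?E = "scale \<sigma> (basis_vec 2)"
  define r where "r = \<Delta> * l"
  define z \<alpha> \<mu> where "z = \<sigma> * (r * u 2)" and "\<alpha> = r * u 1" and "\<mu> = - \<sigma> * (r\<^sup>2 * (u 3 - u 1 * u 2 / 2))"
  note bd = cc_norm_le_1_imp[OF n u]
  have r: "0 < r" "r \<le> l / 4" using l \<open>0 < \<Delta>\<close> \<Delta> by (auto simp: r_def)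
  have \<sigma>\<sigma>: "\<bar>\<sigma>\<bar> = 1" "\<sigma> * \<sigma> = 1" using \<sigma> by auto
  have z: "\<bar>z\<bar> \<le> l / 2"
  proof -
    have "r * \<bar>u 2\<bar> \<le> (l / 4) * 2" using r bd by (intro mult_mono) auto
    then show ?thesis using r \<sigma>\<sigma> by (simp add: z_def abs_mult)
  qed
  have \<alpha>: "\<bar>\<alpha>\<bar> \<le> 2 * \<Delta> * l"
  proof -
    have "r * \<bar>u 1\<bar> \<le> r * 2" using bd(1) r(1) by (intro mult_left_mono) auto
    moreover have "2 * \<Delta> * l = r * 2" by (simp add: r_def)
    moreover have "\<bar>\<alpha>\<bar> = r * \<bar>u 1\<bar>" using r(1) by (simp add: \<alpha>_def abs_mult)
    ultimately show ?thesis by linarith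
  qed
  have \<mu>: "\<bar>\<mu>\<bar> \<le> 3 / 2 * \<Delta> * l\<^sup>2"
  proof -
    have "\<bar>u 1 * u 2\<bar> \<le> 2 * 2" unfolding abs_mult using bd by (intro mult_mono) auto
    then have "\<bar>u 3 - u 1 * u 2 / 2\<bar> \<le> 6" using bd(3) by linarith
    then have "\<bar>\<mu>\<bar> \<le> r\<^sup>2 * 6" using \<sigma>\<sigma> by (auto simp: \<mu>_def abs_mult intro!: mult_left_mono)
    also have "r\<^sup>2 * 6 = \<Delta> * (\<Delta> * 6 * l\<^sup>2)" by (simp add: r_def power2_eq_square)
    also have "\<dots> \<le> \<Delta> * (1 / 4 * 6 * l\<^sup>2)"
      using \<Delta> \<open>0 < \<Delta>\<close> by (intro mult_left_mono mult_right_mono) auto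
    finally show ?thesis by simp
  qed
  obtain \<tau> s where s0: "s 0 = 0" and mono: "mono_on {..<5} \<tau>"
    and M: "\<And>k. k \<le> 5 \<Longrightarrow> \<bar>s k\<bar> \<le> 36 * \<Delta>"
    and at_z: "broken_line 5 \<tau> s z = \<alpha>" "area 5 \<tau> s z = \<mu>"
    and outside: "\<And>t. l \<le> \<bar>t\<bar> \<Longrightarrow> broken_line 5 \<tau> s t = 0 \<and> area 5 \<tau> s t = 0"
    using deformation_slopes_exist[OF l(1) z \<alpha> \<mu>] by metis
  note lift = lift_cc_Lip lift_horizontal lift_direction
  let ?g = "lift n \<sigma> 5 \<tau> s"
  have E: "?E = pt n 0 \<sigma> 0" by (auto simp: scale_def basis_vec_def pt_def)
  have "sqrt (1 + (36 * \<Delta>)\<^sup>2) \<le> 1 + \<eta> * \<Delta>"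
  proof (rule real_le_lsqrt)
    show "1 + (36 * \<Delta>)\<^sup>2 \<le> (1 + \<eta> * \<Delta>)\<^sup>2"
    proof -
      have "(36 * \<Delta>)\<^sup>2 = 1296 * \<Delta> * \<Delta>" by (simp add: power2_eq_square)
      also have "\<dots> \<le> (2 * \<eta>) * \<Delta>" using \<Delta> \<open>0 < \<Delta>\<close> by (intro mult_right_mono) auto
      finally have "(36 * \<Delta>)\<^sup>2 \<le> 2 * \<eta> * \<Delta>" .
      moreover have "(1 + \<eta> * \<Delta>)\<^sup>2 = 1 + 2 * \<eta> * \<Delta> + (\<eta> * \<Delta>)\<^sup>2"
        by (simp add: power2_eq_square algebra_simps)
      ultimately show ?thesis using zero_le_power2[of "\<eta> * \<Delta>"] by linarith
    qed
  qed (use \<open>0 < \<eta>\<close> \<open>0 < \<Delta>\<close> in auto)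
  then have Lip: "cc_Lip n ?g \<le> 1 + \<eta> * \<Delta>"
    using lift(2)[where s = s, OF n \<sigma> s0 mono M] by linarith
  have line: "?g t = scale t ?E" if "\<bar>t\<bar> \<ge> l" for t
    unfolding E scale_pt lift_def using outside[OF that] by (simp add: mult.commute)
  have "inner_n n (dilation (\<Delta> * l) u) (left_inv_field n ?E origin) = z"
    using inner_vertical[of n "dilation (\<Delta> * l) u" \<sigma>] n by (auto simp: dilation_def z_def r_def)
  moreover have "?g z = dilation (\<Delta> * l) u"
  proof -
    have "dilation r u = pt n (r * u 1) (r * u 2) (r\<^sup>2 * u 3)"
      by (subst coords_eq_pt[OF n u(1)]) (auto simp: dilation_def pt_def)
    moreover have \<sigma>z: "\<sigma> * z = r * u 2" using \<sigma>\<sigma> by (simp add: z_def mult.assoc[symmetric])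
    moreover have "\<sigma> * (z * \<alpha> / 2 - \<mu>) = r\<^sup>2 * u 3"
    proof -
      have "\<sigma> * \<mu> = - (r\<^sup>2 * (u 3 - u 1 * u 2 / 2))"
        using \<sigma>\<sigma> by (simp add: \<mu>_def mult.assoc[symmetric])
      moreover have "\<sigma> * (z * \<alpha> / 2 - \<mu>) = (\<sigma> * z) * \<alpha> / 2 - \<sigma> * \<mu>"
        by (simp add: algebra_simps)
      ultimately show ?thesis
        unfolding \<sigma>z by (simp add: \<alpha>_def algebra_simps power2_eq_square)
    qed
    ultimately show ?thesis
      unfolding lift_def at_z r_def[symmetric] by (simp only: \<alpha>_def)
  qed
  moreover have "finite {t. \<not> (\<exists>w. ((\<lambda>r. proj (?g r)) has_vector_derivative w) (at t) \<and>
                     norm (w - proj ?E) \<le> 36 * \<Delta>)}"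
    using lift(4)[where s = s, OF n \<sigma> s0 mono M] by (simp add: E proj_def)
  moreover have "joins_lines n 6 ?g" using joins_lines_lift[where s = s, OF n s0 mono, of \<sigma>] by simp
  ultimately show "\<exists>g. cc_lipschitz n g \<and> horizontal_curve n g \<and> joins_lines n 6 g \<and>
      (\<forall>t. l \<le> \<bar>t\<bar> \<longrightarrow> g t = scale t ?E) \<and>
      g (inner_n n (dilation (\<Delta> * l) u) (left_inv_field n ?E origin)) = dilation (\<Delta> * l) u \<and>
      cc_Lip n g \<le> 1 + \<eta> * \<Delta> \<and>
      finite {t. \<not> (\<exists>w. ((\<lambda>s. proj (g s)) has_vector_derivative w) (at t) \<and>
                              norm (w - proj ?E) \<le> 36 * \<Delta>)}"
    using Lip line lift(1,3)[where s = s, OF n \<sigma> s0 mono M] by (intro exI[of _ ?g]) auto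
qed auto

section \<open>Rigidity of vertical lines for \<open>n \<ge> 4\<close>\<close>

lemma interval_minus_interior_finite:
  fixes I :: "real set"
  assumes "is_interval I"
  shows "finite (I - interior I)"
proof -
  let ?least = "{x \<in> I. \<forall>y\<in>I. x \<le> y}" and ?greatest = "{x \<in> I. \<forall>y\<in>I. y \<le> x}"
  have extremal: "I - interior I \<subseteq> ?least \<union> ?greatest"
  proof
    fix x assume x: "x \<in> I - interior I"
    show "x \<in> ?least \<union> ?greatest"
    proof (rule ccontr)
      assume "x \<notin> ?least \<union> ?greatest"
      then have "\<exists>y\<in>I. y < x" "\<exists>z\<in>I. x < z" using x by (auto simp: not_le)
      then obtain y z where yz: "y \<in> I" "y < x" "z \<in> I" "x < z" by blast
      have "{y<..<z} \<subseteq> I"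
        using assms yz(1,3) unfolding is_interval_1 by (meson greaterThanLessThan_iff less_imp_le subsetI)
      then have "x \<in> interior I" using yz by (intro interiorI[of "{y<..<z}"]) auto
      then show False using x by simp
    qed
  qed
  have fin: "finite A" if "\<And>x y. x \<in> A \<Longrightarrow> y \<in> A \<Longrightarrow> x = y" for A :: "real set"
  proof (cases "A = {}")
    case False
    then obtain x where "x \<in> A" by blast
    with that have "A \<subseteq> {x}" by blast
    then show ?thesis by (rule finite_subset) simp
  qed simp
  have "finite ?least" by (rule fin) (auto intro: antisym)
  moreover have "finite ?greatest" by (rule fin) (auto intro: antisym)
  ultimately show ?thesis by (intro finite_subset[OF extremal]) simp
qed

lemma mono_if_derivative_nonneg:
  fixes f f' :: "real \<Rightarrow> real"
  assumes cont: "continuous_on {a..b} f" and S: "finite S" and ab: "a \<le> b"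
    and der: "\<And>t. t \<in> {a<..<b} - S \<Longrightarrow> (f has_real_derivative f' t) (at t)"
    and pos: "\<And>t. t \<in> {a<..<b} - S \<Longrightarrow> 0 \<le> f' t"
  shows "f a \<le> f b"
proof -
  define h where "h t = (if t \<in> {a<..<b} - S then f' t else 0)" for t
  have "(h has_integral f b - f a) {a..b}"
    by (rule fundamental_theorem_of_calculus_interior_strong[OF S ab _ cont])
       (use der in \<open>auto simp: h_def has_real_derivative_iff_has_vector_derivative[symmetric]\<close>)
  then have "0 \<le> f b - f a" by (rule has_integral_nonneg) (use pos in \<open>auto simp: h_def\<close>)
  then show ?thesis by simp
qed

lemma sd_exp_4:
  assumes "n \<ge> 4"
  shows "sd_exp n x 4 = x 4 - x 1 * x 3 / 2 + (x 1)\<^sup>2 * x 2 / 6"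
  using assms by (simp add: sd_exp_def ad_series_def atMost_Suc eval_nat_numeral)

text \<open>Along a line the controls are constant, and the fourth semidirect product coordinate satisfies
  \<open>v_4' = u_2 a\<^sup>2 / 2\<close>.\<close>

lemma line_coordinates:
  assumes n: "n \<ge> 4" and L: "horizontal_line n L"
  obtains V1 V2 where "\<And>t. ((\<lambda>t. L t 1) has_real_derivative V1) (at t)"
    "\<And>t. ((\<lambda>t. L t 2) has_real_derivative V2) (at t)"
    "\<And>t. ((\<lambda>t. sd_exp n (L t) 4) has_real_derivative V2 * (L t 1)\<^sup>2 / 2) (at t)"
proof -
  obtain q V1 V2 where q: "q \<in> coords n"
    and L_eq: "L = (\<lambda>t. mult n q (scale t (\<lambda>i. V1 * basis_vec 1 i + V2 * basis_vec 2 i)))"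
    using L unfolding horizontal_line_def horizontal_layer_def by blast
  define p where "p = sd_exp n q"
  define e where "e t = sd_exp n (scale t (\<lambda>i. V1 * basis_vec 1 i + V2 * basis_vec 2 i))" for t
  have e: "e t 1 = t * V1" "e t 2 = t * V2" "e t 3 = - t\<^sup>2 * V1 * V2 / 2" "e t 4 = t^3 * V1\<^sup>2 * V2 / 6" for t
    using n unfolding e_def
    by (simp_all add: sd_exp_def ad_series_def scale_def basis_vec_def atMost_Suc eval_nat_numeral)
  have L_sd: "sd_exp n (L t) = sd_mult n p (e t)" for t
    using n by (simp add: L_eq p_def e_def sd_exp_mult)
  have 1: "L t 1 = p 1 + t * V1" for t
    using fun_cong[OF L_sd, of t 1] e(1) by (simp add: sd_mult_def sd_exp_def)
  have 2: "L t 2 = p 2 + t * V2" for t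
    using fun_cong[OF L_sd, of t 2] e(2) n by (simp add: sd_mult_def sd_exp_def ad_series_def)
  have 4: "sd_exp n (L t) 4 = p 4 + t^3 * V1\<^sup>2 * V2 / 6 + p 1 * t\<^sup>2 * V1 * V2 / 2 + (p 1)\<^sup>2 * t * V2 / 2" for t
  proof -
    have "(\<Sum>k\<le>4 - 2. F k) = F 0 + F 1 + F 2" for F :: "nat \<Rightarrow> real"
      by (simp add: atMost_Suc eval_nat_numeral)
    then show ?thesis
      unfolding L_sd sd_mult_def ad_series_def using n e[of t] by (simp add: power2_eq_square)
  qed
  show thesis
  proof (rule that)
    show "((\<lambda>t. L t 1) has_real_derivative V1) (at t)" for t
      unfolding 1 by (auto intro!: derivative_eq_intros)
    show "((\<lambda>t. L t 2) has_real_derivative V2) (at t)" for t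
      unfolding 2 by (auto intro!: derivative_eq_intros)
    show "((\<lambda>t. sd_exp n (L t) 4) has_real_derivative V2 * (L t 1)\<^sup>2 / 2) (at t)" for t
      unfolding 4 1
      by (rule derivative_eq_intros refl | simp)+ (simp add: field_simps power2_eq_square)
  qed
qed

text \<open>The exceptional set consists of the end points of the intervals that belong to them; elsewhere the
  curve agrees with a line in a neighbourhood.\<close>

lemma joins_lines_coordinates:
  assumes n: "n \<ge> 4" and g: "joins_lines n N g"
  obtains S where "finite S" and "\<And>t. t \<notin> S \<Longrightarrow> \<exists>V1 V2.
      ((\<lambda>t. g t 1) has_real_derivative V1) (at t) \<and> ((\<lambda>t. g t 2) has_real_derivative V2) (at t) \<and>
      ((\<lambda>t. sd_exp n (g t) 4) has_real_derivative V2 * (g t 1)\<^sup>2 / 2) (at t)"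
proof -
  obtain m :: nat and I where I: "\<forall>k<m. is_interval (I k)" and cover: "(\<Union>k<m. I k) = UNIV"
    and line: "\<forall>k<m. \<exists>L. horizontal_line n L \<and> (\<forall>t\<in>I k. g t = L t)"
    using g unfolding joins_lines_def by (elim exE conjE) (rule that; assumption)
  define S where "S = (\<Union>k<m. I k - interior (I k))"
  show thesis
  proof (rule that[of S])
    show "finite S" unfolding S_def using I interval_minus_interior_finite by blast
  next
    fix t assume "t \<notin> S"
    then obtain k where k: "k < m" "t \<in> interior (I k)" using cover unfolding S_def by blast
    obtain L where L: "horizontal_line n L" "\<And>t. t \<in> I k \<Longrightarrow> g t = L t" using line k(1) by blast
    obtain V1 V2 where d: "((\<lambda>t. L t 1) has_real_derivative V1) (at t)"
      "((\<lambda>t. L t 2) has_real_derivative V2) (at t)"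
      "((\<lambda>t. sd_exp n (L t) 4) has_real_derivative V2 * (L t 1)\<^sup>2 / 2) (at t)"
      using line_coordinates[OF n L(1)] by metis
    have near_t: "((\<lambda>r. F (g r)) has_real_derivative D) (at t)"
      if "((\<lambda>r. F (L r)) has_real_derivative D) (at t)" for F D
      by (rule has_field_derivative_transform_within_open[OF that open_interior k(2)])
         (use L(2) interior_subset in force)
    have "g t = L t" using L(2) k(2) interior_subset by blast
    then show "\<exists>V1 V2.
      ((\<lambda>t. g t 1) has_real_derivative V1) (at t) \<and> ((\<lambda>t. g t 2) has_real_derivative V2) (at t) \<and>
      ((\<lambda>t. sd_exp n (g t) 4) has_real_derivative V2 * (g t 1)\<^sup>2 / 2) (at t)"
      using near_t[of "\<lambda>x. x 1", OF d(1)] near_t[of "\<lambda>x. x 2", OF d(2)]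
        near_t[of "\<lambda>x. sd_exp n x 4", OF d(3)] by metis
  qed
qed

lemma horizontal_curve_continuous:
  assumes "horizontal_curve n g" "i \<in> {1..n}"
  shows "continuous_on {a..b} (\<lambda>t. g t i)"
proof (cases "a \<le> b")
  case True
  then obtain u1 u2 where "horizontal_with n a b g u1 u2"
    using assms(1) unfolding horizontal_curve_def by blast
  then show ?thesis
    using assms(2) by (intro abs_continuous_imp_continuous_on) (auto simp: horizontal_with_def)
qed simp

text \<open>The function \<open>\<sigma> v_4\<close> is nondecreasing and vanishes at \<open>l\<close> and \<open>- l\<close>, hence it vanishes in
  between.  So does its derivative, and since that is a positive multiple of \<open>a\<^sup>2\<close> off a finite set,
  \<open>a\<close> vanishes there and by continuity everywhere.\<close>

lemma nearly_vertical_rigid: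
  assumes n: "n \<ge> 4" and \<sigma>: "\<sigma> = 1 \<or> \<sigma> = -1" and l: "0 < l"
    and h: "horizontal_curve n g" and g: "joins_lines n N g"
    and line: "\<And>t. l \<le> \<bar>t\<bar> \<Longrightarrow> g t = scale t (scale \<sigma> (basis_vec 2))"
    and dir: "finite {t. \<not> (\<exists>w. ((\<lambda>s. proj (g s)) has_vector_derivative w) (at t) \<and>
                norm (w - (0, \<sigma>)) < 1)}"
    and t: "\<bar>t\<bar> < l"
  shows "g t 1 = 0"
proof -
  obtain S where S: "finite S" and der: "\<And>t. t \<notin> S \<Longrightarrow> \<exists>V1 V2.
      ((\<lambda>t. g t 1) has_real_derivative V1) (at t) \<and> ((\<lambda>t. g t 2) has_real_derivative V2) (at t) \<and>
      ((\<lambda>t. sd_exp n (g t) 4) has_real_derivative V2 * (g t 1)\<^sup>2 / 2) (at t)"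
    using joins_lines_coordinates[OF n g] by metis
  define T where "T = S \<union> {t. \<not> (\<exists>w. ((\<lambda>s. proj (g s)) has_vector_derivative w) (at t) \<and>
                norm (w - (0, \<sigma>)) < 1)}"
  have T: "finite T" using S dir by (simp add: T_def)
  define f where "f t = \<sigma> * sd_exp n (g t) 4" for t
  have f_der: "\<exists>v>0. (f has_real_derivative v * (g t 1)\<^sup>2) (at t)" if t: "t \<notin> T" for t
  proof -
    obtain V1 V2 where V: "((\<lambda>t. g t 1) has_real_derivative V1) (at t)"
      "((\<lambda>t. g t 2) has_real_derivative V2) (at t)"
      "((\<lambda>t. sd_exp n (g t) 4) has_real_derivative V2 * (g t 1)\<^sup>2 / 2) (at t)"
      using der[of t] t unfolding T_def by blast
    obtain w where w: "((\<lambda>s. proj (g s)) has_vector_derivative w) (at t)" "norm (w - (0, \<sigma>)) < 1"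
      using t unfolding T_def by blast
    have "((\<lambda>s. proj (g s)) has_vector_derivative (V1, V2)) (at t)"
      unfolding proj_def using V(1,2)
      by (intro has_vector_derivative_Pair) (auto simp: has_real_derivative_iff_has_vector_derivative)
    then have "w = (V1, V2)" using w(1) vector_derivative_unique_at by blast
    then have "\<bar>V2 - \<sigma>\<bar> < 1"
      using w(2) norm_snd_le[of "V2 - \<sigma>" V1] by simp
    then have "\<sigma> * V2 / 2 > 0" using \<sigma> by auto
    moreover have "(f has_real_derivative \<sigma> * V2 / 2 * (g t 1)\<^sup>2) (at t)"
      unfolding f_def using DERIV_cmult[OF V(3), of \<sigma>] by (simp add: mult.assoc)
    ultimately show ?thesis by blast
  qed
  have cont: "continuous_on {a..b} (\<lambda>t. g t i)" if "i \<in> {1, 2, 3, 4}" for i a b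
    using horizontal_curve_continuous[OF h] that n by auto
  have f_cont: "continuous_on {a..b} f" for a b
    unfolding f_def sd_exp_4[OF n] by (intro continuous_intros cont) auto
  obtain v where v: "\<And>t. t \<notin> T \<Longrightarrow> v t > 0 \<and> (f has_real_derivative v t * (g t 1)\<^sup>2) (at t)"
    using f_der by metis
  have mono: "f a \<le> f b" if "a \<le> b" for a b
    by (rule mono_if_derivative_nonneg[OF f_cont T that, where f' = "\<lambda>t. v t * (g t 1)\<^sup>2"])
       (use v in \<open>auto simp: less_imp_le\<close>)
  have "f l = 0" "f (- l) = 0"
    using line[of l] line[of "- l"] l by (auto simp: f_def sd_exp_4[OF n] scale_def basis_vec_def)
  then have f0: "f t = 0" if "t \<in> {-l<..<l}" for t
    using mono[of "- l" t] mono[of t l] that by auto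
  have g0: "g t 1 = 0" if "t \<in> {-l<..<l} - T" for t
  proof -
    have "(f has_real_derivative 0) (at t)"
      by (rule has_field_derivative_transform_within_open[of "\<lambda>_. 0" _ _ "{-l<..<l}"])
         (use that f0 in auto)
    then have "v t * (g t 1)\<^sup>2 = 0" using v[of t] that DERIV_unique by blast
    then show ?thesis using v[of t] that by simp
  qed
  show ?thesis
  proof (rule ccontr)
    assume "g t 1 \<noteq> 0"
    have "open {r \<in> {-l<..<l}. g r 1 \<noteq> 0}"
    proof -
      have "continuous_on {-l<..<l} (\<lambda>t. g t 1)"
        by (rule continuous_on_subset[OF cont[of 1 "-l" l]]) auto
      from continuous_open_preimage[OF this, of "- {0}"]
      have "open ({-l<..<l} \<inter> (\<lambda>t. g t 1) -` (- {0}))" by (simp add: open_Compl)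
      moreover have "{-l<..<l} \<inter> (\<lambda>t. g t 1) -` (- {0}) = {r \<in> {-l<..<l}. g r 1 \<noteq> 0}" by auto
      ultimately show ?thesis by simp
    qed
    moreover have "{r \<in> {-l<..<l}. g r 1 \<noteq> 0} \<subseteq> T" using g0 by blast
    then have "finite {r \<in> {-l<..<l}. g r 1 \<noteq> 0}" using T by (rule finite_subset)
    moreover have "t \<in> {r \<in> {-l<..<l}. g r 1 \<noteq> 0}" using t \<open>g t 1 \<noteq> 0\<close> by auto
    ultimately show False using finite_imp_not_open by blast
  qed
qed

lemma cc_norm_X1:
  assumes n: "n \<ge> 2"
  shows "cc_norm n (basis_vec 1) \<le> 1"
proof -
  let ?X = "basis_vec 1"
  have X: "?X \<in> coords n" using n by (auto simp: coords_def basis_vec_def)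
  have field: "left_inv_field n ?X (scale c ?X) i = ?X i" for c i
  proof -
    have "((\<lambda>t. (c + t) * ?X i) has_real_derivative ?X i) (at 0)"
      by (auto intro!: derivative_eq_intros)
    then show ?thesis
      using n X by (simp add: left_inv_field_def filiform_one_param scale_def[of "_ + _"] DERIV_imp_deriv)
  qed
  have "horizontal_with n 0 1 (\<lambda>t. scale (1 - t) ?X) (\<lambda>t. -1) (\<lambda>t. 0)"
  proof (rule horizontal_withI[where S = "{}" and D = "\<lambda>t i. - ?X i"])
    show "((\<lambda>s. scale (1 - s) ?X i) has_real_derivative - ?X i) (at t)" for t i
      unfolding scale_def by (auto intro!: derivative_eq_intros)
    show "set_integrable lebesgue {0..1::real} (\<lambda>t. -1 :: real)" "set_integrable lebesgue {0..1::real} (\<lambda>t. 0 :: real)"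
      by (auto intro!: absolutely_integrable_on_const)
    show "continuous_on {0..1} (\<lambda>t. scale (1 - t) ?X i)" for i
      unfolding scale_def by (intro continuous_intros)
  qed (use X in \<open>auto simp: scale_coords field[simplified]\<close>)
  from cc_dist_le[OF this, of 1]
  show ?thesis by (simp add: cc_norm_def scale_def origin_def norm_Pair)
qed

text \<open>The point \<open>u = X_1\<close> violates the definition.  For it \<open>\<zeta> = 0\<close>, so a deformation would have
  to satisfy \<open>a(0) = \<Delta> l > 0\<close>.\<close>

lemma vertical_not_deformable:
  assumes n: "n \<ge> 4" and \<sigma>: "\<sigma> = 1 \<or> \<sigma> = -1"
  shows "\<not> deformable n (scale \<sigma> (basis_vec 2))"
proof
  let ?E = "scale \<sigma> (basis_vec 2)" and ?u = "basis_vec 1"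
  assume "deformable n ?E"
  then obtain C N D where C: "C > 0" and D: "\<forall>\<eta>>0. D \<eta> > (0::real)"
    and ex: "\<forall>l \<eta> \<Delta> u. 0 < l \<and> l < 1 \<and> 0 < \<eta> \<and> 0 < \<Delta> \<and> \<Delta> < D \<eta> \<and>
             u \<in> coords n \<and> cc_norm n u \<le> 1 \<longrightarrow>
           (\<exists>g. cc_lipschitz n g \<and> horizontal_curve n g \<and> joins_lines n N g \<and>
              (\<forall>t. \<bar>t\<bar> \<ge> l \<longrightarrow> g t = scale t ?E) \<and>
              g (inner_n n (dilation (\<Delta> * l) u) (left_inv_field n ?E origin)) = dilation (\<Delta> * l) u \<and>
              cc_Lip n g \<le> 1 + \<eta> * \<Delta> \<and>
              finite {t. \<not> (\<exists>w. ((\<lambda>s. proj (g s)) has_vector_derivative w) (at t) \<and>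
                              norm (w - proj ?E) \<le> C * \<Delta>)})"
    unfolding deformable_def by (elim exE conjE) (rule that; assumption)
  \<comment> \<open>\<open>C \<Delta> < 1\<close> keeps the second control away from 0\<close>
  define \<Delta> where "\<Delta> = min (D 1) (1 / C) / 2"
  have \<Delta>: "0 < \<Delta>" "\<Delta> < D 1" "C * \<Delta> < 1"
    using C D[rule_format, of 1] by (auto simp: \<Delta>_def min_def field_simps)
  have u: "?u \<in> coords n" "cc_norm n ?u \<le> 1"
    using n cc_norm_X1[of n] by (auto simp: coords_def basis_vec_def)
  have "0 < (1 / 2 :: real) \<and> (1 / 2 :: real) < 1 \<and> 0 < (1 :: real) \<and> 0 < \<Delta> \<and> \<Delta> < D 1 \<and>
      ?u \<in> coords n \<and> cc_norm n ?u \<le> 1"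
    using \<Delta>(1,2) u by simp
  from ex[THEN spec, THEN spec, THEN spec, THEN spec, THEN mp, OF this]
  obtain g where g: "horizontal_curve n g" "joins_lines n N g"
    and line: "\<forall>t. \<bar>t\<bar> \<ge> 1 / 2 \<longrightarrow> g t = scale t ?E"
    and z: "g (inner_n n (dilation (\<Delta> * (1 / 2)) ?u) (left_inv_field n ?E origin)) = dilation (\<Delta> * (1 / 2)) ?u"
    and dir: "finite {t. \<not> (\<exists>w. ((\<lambda>s. proj (g s)) has_vector_derivative w) (at t) \<and>
                              norm (w - proj ?E) \<le> C * \<Delta>)}"
    by (elim exE conjE) (rule that; assumption)
  have E: "proj ?E = (0, \<sigma>)" by (simp add: proj_def scale_def basis_vec_def)
  have fin: "finite {t. \<not> (\<exists>w. ((\<lambda>s. proj (g s)) has_vector_derivative w) (at t) \<and> norm (w - (0, \<sigma>)) < 1)}"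
    by (rule finite_subset[OF _ dir]) (unfold E, use \<Delta>(3) in \<open>auto simp del: split_paired_Ex dest: le_less_trans\<close>)
  have "g 0 1 = 0"
    by (rule nearly_vertical_rigid[where l = "1 / 2", OF n \<sigma> _ g _ fin]) (use line in simp_all)
  moreover have "inner_n n (dilation (\<Delta> * (1 / 2)) ?u) (left_inv_field n ?E origin) = 0"
    using inner_vertical[of n "dilation (\<Delta> * (1 / 2)) ?u" \<sigma>] n by (simp add: dilation_def basis_vec_def)
  ultimately have "dilation (\<Delta> * (1 / 2)) ?u 1 = 0" using z by simp
  then show False using \<Delta>(1) by (simp add: dilation_def basis_vec_def)
qed

theorem corollary3p4:
  fixes n :: nat
  assumes "n \<ge> 2"
  shows "(n = 2 \<or> n = 3 \<longrightarrow> deformable n (basis_vec 2) \<and> deformable n (scale (-1) (basis_vec 2))) \<and>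
         (n \<ge> 4 \<longrightarrow> \<not> deformable n (basis_vec 2) \<and> \<not> deformable n (scale (-1) (basis_vec 2)))"
proof -
  have "basis_vec 2 = scale 1 (basis_vec 2)" by (simp add: scale_def)
  then show ?thesis
    using vertical_deformable[of n 1] vertical_deformable[of n "-1"]
      vertical_not_deformable[of n 1] vertical_not_deformable[of n "-1"]
    by simp
qed

end
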